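(* Let $(\hat u,\hat z)$ be a strong-detonation profile, as defined in the context, with parameters $D>0$, $k>0$, $q$, $u_+$, $u_-$, $u_{\mathrm{ig}}$, $\mathcal{E}_A$ and ignition function $\phi$. Consider the integrated eigenvalue equations $$\lambda w = (1-\hat u)\,w' + q\,\hat u\, z + q(D-1)\,z' + w'',$$ $$\lambda z + k\big(\phi(\hat u) - q\,\phi'(\hat u)\hat z\big) z = z' - k\,\phi'(\hat u)\hat z\, w' + D z''$$ on $\mathbb{R}$, where $'=\mathrm{d}/\mathrm{d}x$. Then any eigenvalue $\lambda\in\mathbb{C}$ of this system with $\operatorname{Re}\lambda\ge 0$ satisfies $$\operatorname{Re}\lambda+|\operatorname{Im}\lambda|\le \max\left\{4,\ \frac{1}{4D}+\left(\frac14+\frac12|D-1|^2\right)kL+kM\right\},$$ where $$L:=\sup_{x\in\mathbb{R}}\phi'(\hat u(x))\,\hat z(x)\qquad\text{and}\qquad M:=\sup_{x\in\mathbb{R}}\Big((1+q)\,\phi'(\hat u(x))\,\hat z(x)-\phi(\hat u(x))\Big).$$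
   Context: The rescaled scalar Majda combustion model (Burgers flux, wave speed $s=1$, viscosity $B=1$), written in the frame moving with the wave, is $$u_t-u_x+(u^2/2)_x=u_{xx}+qk\phi(u)z,\qquad z_t-z_x=Dz_{xx}-k\phi(u)z,$$ with constants $q>0$ (heat release), $k>0$ (reaction rate), $D>0$ (diffusion coefficient). The unknown $z\in[0,1]$ is the mass fraction of reactant. The ignition function is of Arrhenius type: with ignition threshold $u_{\mathrm{ig}}$ and activation energy $\mathcal{E}_A>0$, $$\phi(u)=0\ \text{ if } u\le u_{\mathrm{ig}},\qquad \phi(u)=e^{-\mathcal{E}_A/(u-u_{\mathrm{ig}})}\ \text{ if } u>u_{\mathrm{ig}}.$$ A strong-detonation profile is a smooth time-independent solution $(\hat u(x),\hat z(x))$, $x\in\mathbb{R}$, of this system, i.e. $$-\hat u'+(\hat u^2/2)'=\hat u''+qk\phi(\hat u)\hat z,\qquad -\hat z'=D\hat z''-k\phi(\hat u)\hat z,$$ with $0\le\hat z\le 1$, with $(\hat u,\hat z)(x)\to(u_-,0)$ as $x\to-\infty$ and $(\hat u,\hat z)(x)\to(u_+,1)$ as $x\to+\infty$ (and $\hat u',\hat z'\to 0$ as $x\to\pm\infty$). The end states satisfy $0\le u_+<u_{\mathrm{ig}}<u_-$, the strong detonation condition $u_->1>u_+$, and the Rankine–Hugoniot condition, so that $0<q<\frac12(1-u_+)^2$ and $$u_-=1+\sqrt{(1-u_+)^2-2q}.$$ The integrated eigenvalue equations arise from linearizing the system about $(\hat u,\hat z)$, looking for solutions $e^{\lambda t}(u(x),z(x))$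 of the linearized system, and introducing the integrated variable $w$ with $w'=u+qz$. A number $\lambda\in\mathbb{C}$ is an eigenvalue of the integrated eigenvalue equations if there exists a pair of functions $(w,z)\in H^2(\mathbb{R};\mathbb{C})\times H^2(\mathbb{R};\mathbb{C})$, not identically zero, satisfying both equations. *)

theory Defs
  imports "HOL-Analysis.Analysis"
begin

definition smooth :: "(real \<Rightarrow> real) \<Rightarrow> bool" where
  "smooth f \<longleftrightarrow> (\<forall>n x. (deriv ^^ n) f differentiable at x)"

definition test_function :: "(real \<Rightarrow> real) \<Rightarrow> bool" where
  "test_function f \<longleftrightarrow> smooth f \<and> compact (closure {x. f x \<noteq> 0})"

text \<open>
  The Sobolev space $H^2(\mathbb{R};\mathbb{C})$ via weak derivatives. Its elements are represented
  by functions, so statements about them are to be read modulo null sets.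
\<close>

definition weak_deriv :: "(real \<Rightarrow> complex) \<Rightarrow> (real \<Rightarrow> complex) \<Rightarrow> bool" where
  "weak_deriv f g \<longleftrightarrow>
     (\<forall>a b. f absolutely_integrable_on {a..b}) \<and>
     (\<forall>a b. g absolutely_integrable_on {a..b}) \<and>
     (\<forall>\<psi>. test_function \<psi> \<longrightarrow>
        (LINT x|lebesgue. deriv \<psi> x *\<^sub>R f x) = - (LINT x|lebesgue. \<psi> x *\<^sub>R g x))"

definition L2 :: "(real \<Rightarrow> complex) \<Rightarrow> bool" where
  "L2 f \<longleftrightarrow> f \<in> borel_measurable lebesgue \<and> integrable lebesgue (\<lambda>x. (cmod (f x))\<^sup>2)"

text \<open>
  \<open>H2 f f' f''\<close>: \<open>f\<close> lies in $H^2$, and \<open>f'\<close>, \<open>f''\<close> are its first and second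
  weak derivatives (which \<open>f\<close> determines up to null sets).
\<close>

definition H2 :: "(real \<Rightarrow> complex) \<Rightarrow> (real \<Rightarrow> complex) \<Rightarrow> (real \<Rightarrow> complex) \<Rightarrow> bool" where
  "H2 f f' f'' \<longleftrightarrow> L2 f \<and> L2 f' \<and> L2 f'' \<and> weak_deriv f f' \<and> weak_deriv f' f''"

definition ignition :: "real \<Rightarrow> real \<Rightarrow> real \<Rightarrow> real" where
  "ignition u_ig E_A u = (if u \<le> u_ig then 0 else exp (- E_A / (u - u_ig)))"

text \<open>
  The conditions on \<open>q\<close>, \<open>u_plus\<close>, \<open>u_minus\<close> below include the Rankine--Hugoniot condition
  $(u_- - 1)^2 = (u_+ - 1)^2 - 2q$.
\<close>

definition strong_detonation_profile ::
  "real \<Rightarrow> real \<Rightarrow> real \<Rightarrow> real \<Rightarrow> real \<Rightarrow> real \<Rightarrow> (real \<Rightarrow> real)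
    \<Rightarrow> (real \<Rightarrow> real) \<Rightarrow> (real \<Rightarrow> real) \<Rightarrow> bool" where
  "strong_detonation_profile D k q u_plus u_minus u_ig \<phi> u z \<longleftrightarrow>
     0 \<le> u_plus \<and> u_plus < u_ig \<and> u_ig < u_minus \<and>
     u_plus < 1 \<and> 1 < u_minus \<and>
     0 < q \<and> q < (1 - u_plus)\<^sup>2 / 2 \<and>
     u_minus = 1 + sqrt ((1 - u_plus)\<^sup>2 - 2 * q) \<and>
     smooth u \<and> smooth z \<and>
     (\<forall>x. - deriv u x + deriv (\<lambda>y. (u y)\<^sup>2 / 2) x
            = deriv (deriv u) x + q * k * \<phi> (u x) * z x) \<and>
     (\<forall>x. - deriv z x = D * deriv (deriv z) x - k * \<phi> (u x) * z x) \<and>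
     (\<forall>x. 0 \<le> z x \<and> z x \<le> 1) \<and>
     (u \<longlongrightarrow> u_minus) at_bot \<and> (z \<longlongrightarrow> 0) at_bot \<and>
     (u \<longlongrightarrow> u_plus) at_top \<and> (z \<longlongrightarrow> 1) at_top \<and>
     (deriv u \<longlongrightarrow> 0) at_bot \<and> (deriv z \<longlongrightarrow> 0) at_bot \<and>
     (deriv u \<longlongrightarrow> 0) at_top \<and> (deriv z \<longlongrightarrow> 0) at_top"

definition integrated_eigenvalue ::
  "real \<Rightarrow> real \<Rightarrow> real \<Rightarrow> (real \<Rightarrow> real) \<Rightarrow> (real \<Rightarrow> real) \<Rightarrow> (real \<Rightarrow> real)
    \<Rightarrow> complex \<Rightarrow> bool" where
  "integrated_eigenvalue D k q \<phi> uh zh lam \<longleftrightarrow>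
     (\<exists>w w' w'' z z' z''.
        H2 w w' w'' \<and> H2 z z' z'' \<and>
        \<not> (AE x in lebesgue. w x = 0 \<and> z x = 0) \<and>
        (AE x in lebesgue.
           lam * w x = of_real (1 - uh x) * w' x + of_real (q * uh x) * z x
             + of_real (q * (D - 1)) * z' x + w'' x) \<and>
        (AE x in lebesgue.
           lam * z x + of_real (k * (\<phi> (uh x) - q * deriv \<phi> (uh x) * zh x)) * z x
             = z' x - of_real (k * deriv \<phi> (uh x) * zh x) * w' x + of_real D * z'' x))"

end

theory Submission
  imports Defs "HOL-Computational_Algebra.Polynomial"
begin

text \<open>
The bound is an energy estimate. Multiply the equation for \<open>w\<close> by the conjugate of \<open>w\<close>, the equation
for \<open>z\<close> by the conjugate of \<open>z\<close>, integrate over the line and integrate by parts. To read off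
\<open>Re \<lambda> + \<bar>Im \<lambda>\<bar>\<close> from an identity \<open>\<lambda> N = I\<close> with \<open>N \<ge> 0\<close>, multiply by \<open>1 \<mp> i\<close>, the sign being that of
\<open>Im \<lambda>\<close>: the real part of \<open>(1 \<mp> i) \<lambda>\<close> is \<open>Re \<lambda> + \<bar>Im \<lambda>\<bar>\<close>, and the factor costs only its modulus
\<open>\<surd>2\<close> on the other terms. Write \<open>\<mu> = Re \<lambda> + \<bar>Im \<lambda>\<bar>\<close> and let \<open>W\<close>, \<open>W'\<close>, \<open>Z\<close> be the integrals of the squared moduli of
\<open>w\<close>, \<open>w'\<close>, \<open>z\<close>.

For \<open>w\<close> the coefficients are small: any profile satisfies \<open>0 \<le> u \<le> 2\<close>, and \<open>q \<le> 1/2\<close>, so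
\<open>\<bar>1 - u\<bar> \<le> 1\<close>, \<open>\<bar>q u\<bar> \<le> 1\<close> and \<open>\<bar>q (D - 1)\<bar> \<le> \<bar>D - 1\<bar> / 2\<close>. After moving the derivative off \<open>z'\<close>, Young's inequality
gives
  \<open>\<mu> W + W' / 2 \<le> 4 W + (1/4 + \<bar>D - 1\<bar>\<^sup>2 / 2) Z\<close> (\<open>energy_estimate_w\<close>).
For \<open>z\<close> the transport term, the integral of \<open>z'\<close> times the conjugate of \<open>z\<close>, is purely imaginary, so it enters
without the factor \<open>\<surd>2\<close> and diffusion absorbs it at the price \<open>1 / (4 D)\<close>. The coupling to \<open>w'\<close> is split between \<open>Z\<close>
and \<open>W'\<close>, which yields
  \<open>\<mu> Z \<le> (1 / (4 D) + k M) Z + k L W' / 2\<close> (\<open>energy_estimate_z\<close>).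
If \<open>\<mu> > 4\<close> the first estimate bounds \<open>W' / 2\<close> by a multiple of \<open>Z\<close>, and inserting this into the second gives the
claimed bound unless \<open>Z = 0\<close>. If \<open>Z = 0\<close>, the first estimate forces \<open>W = 0\<close>, which is excluded
for an eigenfunction.

The bounds on the profile (\<open>profile_range\<close>) come from two conserved or monotone fluxes. By the \<open>z\<close>-equation
\<open>D z' + z\<close> is nondecreasing, with limit 1, so it is at most 1. Adding \<open>q\<close> times the \<open>z\<close>-equation to the \<open>u\<close>-equation gives a
first integral, and with the flux bound it reads \<open>u' \<ge> ((u - 1)\<^sup>2 - (1 - u\<^sub>+)\<^sup>2) / 2\<close>. Hence \<open>u\<close> increases wherever it
lies above \<open>2 - u\<^sub>+\<close> or below \<open>u\<^sub>+\<close>, and either is incompatible with its limits.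

What remains is integration by parts on the line for functions with square integrable weak derivatives. A weak
derivative is first turned into an indefinite integral by the du Bois-Reymond lemma (\<open>weak_deriv_imp_primitive\<close>);
indefinite integrals satisfy the product rule (\<open>primitive_of_mult\<close>); and the boundary terms vanish because an
integrable function cannot stay away from 0 at infinity (\<open>H1_integration_by_parts\<close>). The test functions needed for
the du Bois-Reymond lemma are products of two ignition functions.
\<close>

section \<open>Smooth functions of a real variable\<close>

text \<open>
To see that a function has derivatives of all orders it suffices to put it into a class of differentiable
functions that is closed under differentiation. This replaces every induction on the order of the derivative below.
\<close>

lemma smooth_coinduct:
  assumes "f \<in> S"
    and step: "\<And>g. g \<in> S \<Longrightarrow> \<exists>g'\<in>S. \<forall>x. (g has_real_derivative g' x) (at x)"
  shows "smooth f"
proof -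
  have "(deriv ^^ n) f \<in> S" for n
  proof (induction n)
    case (Suc n)
    from step[OF Suc] obtain g' where g': "g' \<in> S"
      "\<And>x. ((deriv ^^ n) f has_real_derivative g' x) (at x)" by blast
    have "deriv ((deriv ^^ n) f) = g'"
      using g'(2) by (intro ext DERIV_imp_deriv)
    then show ?case using g'(1) by simp
  qed (use assms(1) in simp)
  then show ?thesis
    unfolding smooth_def using step by (meson real_differentiable_def)
qed

lemma smooth_deriv: "smooth f \<Longrightarrow> smooth (deriv f)"
  unfolding smooth_def by (metis comp_apply funpow_Suc_right)

lemma smooth_DERIV: "smooth f \<Longrightarrow> (f has_real_derivative deriv f x) (at x)"
  unfolding smooth_def
  by (metis DERIV_deriv_iff_real_differentiable eq_id_iff funpow_0)

lemma smooth_DERIV': "smooth f \<Longrightarrow> (f has_real_derivative deriv f x) (at x within S)"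
  by (rule DERIV_subset[OF smooth_DERIV]) auto

lemma smooth_continuous_on: "smooth f \<Longrightarrow> continuous_on S f"
  using smooth_DERIV DERIV_isCont continuous_at_imp_continuous_on by blast

lemma smooth_if_deriv_smooth:
  assumes "\<And>x. (f has_real_derivative g x) (at x)" "smooth g"
  shows "smooth f"
proof (rule smooth_coinduct[of f "insert f {g. smooth g}"])
  show "\<exists>g'\<in>insert f {g. smooth g}. \<forall>x. (h has_real_derivative g' x) (at x)"
    if "h \<in> insert f {g. smooth g}" for h
    using that assms smooth_deriv smooth_DERIV by (metis insert_iff mem_Collect_eq)
qed simp

text \<open>
Products of two smooth functions are not closed under differentiation, but by the Leibniz rule their finite sums
are; this class is the one to which the coinduction principle is applied.
\<close>

inductive_set product_sums :: "(real \<Rightarrow> real) set" where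
  product: "smooth f \<Longrightarrow> smooth g \<Longrightarrow> (\<lambda>x. f x * g x) \<in> product_sums"
| sum: "u \<in> product_sums \<Longrightarrow> v \<in> product_sums \<Longrightarrow> (\<lambda>x. u x + v x) \<in> product_sums"

lemma product_sums_smooth:
  assumes "u \<in> product_sums" shows "smooth u"
  using assms
proof (rule smooth_coinduct)
  show "\<exists>u'\<in>product_sums. \<forall>x. (u has_real_derivative u' x) (at x)" if "u \<in> product_sums" for u
    using that
  proof induction
    case (product f g)
    then have "(\<lambda>x. deriv f x * g x + deriv g x * f x) \<in> product_sums"
      by (intro product_sums.intros smooth_deriv)
    moreover have "((\<lambda>x. f x * g x) has_real_derivative deriv f x * g x + deriv g x * f x) (at x)" for x
      using product by (intro DERIV_mult smooth_DERIV)
    ultimately show ?case by (intro bexI[of _ "\<lambda>x. deriv f x * g x + deriv g x * f x"]) auto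
  next
    case (sum u v)
    then obtain u' v' where "u' \<in> product_sums" "v' \<in> product_sums"
      "\<And>x. (u has_real_derivative u' x) (at x)" "\<And>x. (v has_real_derivative v' x) (at x)" by blast
    then show ?case
      by (intro bexI[of _ "\<lambda>x. u' x + v' x"] allI DERIV_add product_sums.sum) auto
  qed
qed

lemma smooth_mult: "smooth f \<Longrightarrow> smooth g \<Longrightarrow> smooth (\<lambda>x. f x * g x)"
  by (rule product_sums_smooth[OF product_sums.product])

lemma smooth_const: "smooth (\<lambda>x. c)"
proof (rule smooth_coinduct[of _ "range (\<lambda>c x. c)"])
  show "\<exists>g'\<in>range (\<lambda>c x. c). \<forall>x. (g has_real_derivative g' x) (at x)"
    if "g \<in> range (\<lambda>c x. c)" for g :: "real \<Rightarrow> real"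
    using that by (intro bexI[of _ "\<lambda>x. 0"]) auto
qed simp

lemma smooth_linear_comb:
  assumes "smooth f" "smooth g" shows "smooth (\<lambda>x. a * f x + b * g x)"
  by (rule product_sums_smooth[OF product_sums.sum]; rule product_sums.product; rule smooth_const assms)

lemma smooth_reflect:
  assumes "smooth f" shows "smooth (\<lambda>x. f (- x))"
proof (rule smooth_coinduct[of _ "{\<lambda>x. c * f (- x) | c f. smooth f}"])
  show "(\<lambda>x. f (- x)) \<in> {\<lambda>x. c * f (- x) | c f. smooth f}"
    using assms by (intro CollectI exI[of _ 1] exI[of _ f]) auto
  fix g :: "real \<Rightarrow> real" assume "g \<in> {\<lambda>x. c * f (- x) | c f. smooth f}"
  then obtain c f where g: "g = (\<lambda>x. c * f (- x))" and f: "smooth f" by blast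
  have "(g has_real_derivative - c * deriv f (- x)) (at x)" for x
  proof -
    have "((\<lambda>x. f (- x)) has_real_derivative deriv f (- x) * - 1) (at x)"
      by (intro DERIV_chain2[OF smooth_DERIV[OF f]]) (auto intro!: derivative_eq_intros)
    from DERIV_cmult[OF this, of c] show ?thesis by (simp add: g)
  qed
  with f show "\<exists>g'\<in>{\<lambda>x. c * f (- x) | c f. smooth f}. \<forall>x. (g has_real_derivative g' x) (at x)"
    by (intro bexI[of _ "\<lambda>x. - c * deriv f (- x)"] CollectI exI[of _ "-c"] exI[of _ "deriv f"])
      (auto intro: smooth_deriv)
qed

section \<open>The ignition function and smooth cut-offs\<close>

lemma poly_exp_neg_tendsto_0:
  fixes p :: "real poly" assumes "E > 0"
  shows "((\<lambda>y. poly p y * exp (- E * y)) \<longlongrightarrow> 0) at_top"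
proof -
  have "((\<lambda>y. coeff p i * (y ^ i * exp (- E * y))) \<longlongrightarrow> coeff p i * 0) at_top" for i
  proof (rule tendsto_mult_left)
    have "filterlim (\<lambda>y. E * y) at_top at_top"
      using assms by (intro filterlim_tendsto_pos_mult_at_top[OF tendsto_const] filterlim_ident)
    from filterlim_compose[OF tendsto_power_div_exp_0 this]
    have "((\<lambda>y. (E * y) ^ i / exp (E * y) / E ^ i) \<longlongrightarrow> 0 / E ^ i) at_top"
      using assms by (intro tendsto_divide) auto
    moreover have "(E * y) ^ i / exp (E * y) / E ^ i = y ^ i * exp (- E * y)" for y
      using assms by (simp add: power_mult_distrib exp_minus field_simps)
    ultimately show "((\<lambda>y. y ^ i * exp (- E * y)) \<longlongrightarrow> 0) at_top" by simp
  qed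
  then have "((\<lambda>y. \<Sum>i\<le>degree p. coeff p i * (y ^ i * exp (- E * y))) \<longlongrightarrow> (\<Sum>i\<le>degree p. 0)) at_top"
    by (intro tendsto_sum) simp
  then show ?thesis by (simp add: poly_altdef sum_distrib_right mult.assoc)
qed

text \<open>
The derivatives of the ignition function are polynomials in \<open>1 / (x - c)\<close> times the same exponential, so these
functions form the differentiation-closed class that contains it.
\<close>

definition flat_function :: "real \<Rightarrow> real \<Rightarrow> real poly \<Rightarrow> real \<Rightarrow> real" where
  "flat_function c E p x = (if x \<le> c then 0 else poly p (1 / (x - c)) * exp (- E / (x - c)))"

text \<open>
With \<open>y = 1 / (x - c)\<close> one has \<open>y' = - y\<^sup>2\<close>, whence the polynomial \<open>y\<^sup>2 (E p - p')\<close>. At the threshold \<open>c\<close> the right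
difference quotient is \<open>y p(y) exp (- E y)\<close> with \<open>y\<close> tending to infinity, so the exponential makes it vanish.
\<close>

lemma flat_function_DERIV:
  assumes "E > 0"
  shows "(flat_function c E p has_real_derivative
      flat_function c E ([:0, 0, 1:] * (smult E p - pderiv p)) x) (at x)"
proof (cases x c rule: linorder_cases)
  case less
  have "((\<lambda>x. 0) has_real_derivative 0) (at x)" by simp
  moreover have "eventually (\<lambda>y. flat_function c E p y = 0) (nhds x)"
    using eventually_nhds_in_open[of "{..<c}" x] less
    by (auto elim!: eventually_mono simp: flat_function_def)
  ultimately show ?thesis
    using less DERIV_cong_ev[of x x "flat_function c E p" "\<lambda>x. 0"] by (simp add: flat_function_def)
next
  case greater
  let ?y = "1 / (x - c)"
  have "((\<lambda>x. poly p (1 / (x - c)) * exp (- E / (x - c))) has_real_derivative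
      poly ([:0, 0, 1:] * (smult E p - pderiv p)) ?y * exp (- E / (x - c))) (at x)"
  proof -
    have 1: "((\<lambda>x. 1 / (x - c)) has_real_derivative - (?y\<^sup>2)) (at x)"
      using greater by (auto intro!: derivative_eq_intros simp: field_simps power2_eq_square)
    have 2: "((\<lambda>x. exp (- E * (1 / (x - c)))) has_real_derivative
        exp (- E * ?y) * (- E * - (?y\<^sup>2))) (at x)"
      by (intro DERIV_chain2[OF DERIV_exp] DERIV_cmult 1)
    show ?thesis
      using DERIV_mult[OF DERIV_chain2[OF poly_DERIV 1] 2, of p]
      by (simp add: algebra_simps power2_eq_square)
  qed
  moreover have "eventually (\<lambda>y. flat_function c E p y = poly p (1 / (y - c)) * exp (- E / (y - c))) (nhds x)"
    using eventually_nhds_in_open[of "{c<..}" x] greater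
    by (auto elim!: eventually_mono simp: flat_function_def)
  ultimately show ?thesis
    using greater DERIV_cong_ev[of x x "flat_function c E p"
        "\<lambda>x. poly p (1 / (x - c)) * exp (- E / (x - c))"]
    by (simp add: flat_function_def)
next
  case equal
  have "filterlim (\<lambda>h. inverse h) at_top (at_right (0::real))"
    by (rule filterlim_inverse_at_top_right)
  from filterlim_compose[OF poly_exp_neg_tendsto_0[OF assms, of "[:0, 1:] * p"] this]
  have "((\<lambda>h. inverse h * poly p (inverse h) * exp (- E * inverse h)) \<longlongrightarrow> 0) (at_right 0)"
    by simp
  then have R: "((\<lambda>h. (flat_function c E p (c + h) - flat_function c E p c) / h) \<longlongrightarrow> 0) (at_right 0)"
    by (rule Lim_transform_eventually)
      (auto simp: eventually_at_filter flat_function_def field_simps)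
  have L: "((\<lambda>h. (flat_function c E p (c + h) - flat_function c E p c) / h) \<longlongrightarrow> 0) (at_left 0)"
    by (rule tendsto_eventually) (auto simp: eventually_at_filter flat_function_def)
  have "(flat_function c E p has_real_derivative 0) (at c)"
    unfolding DERIV_def using L R by (simp add: filterlim_split_at)
  then show ?thesis by (simp add: equal flat_function_def)
qed

lemma flat_function_smooth: "E > 0 \<Longrightarrow> smooth (flat_function c E p)"
  by (rule smooth_coinduct[of _ "range (flat_function c E)"]) (auto intro!: flat_function_DERIV)

lemma ignition_eq_flat_function: "ignition c E = flat_function c E 1"
  by (rule ext) (simp add: ignition_def flat_function_def)

lemma ignition_smooth: "E > 0 \<Longrightarrow> smooth (ignition c E)"
  by (simp add: ignition_eq_flat_function flat_function_smooth)

lemma deriv_ignition: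
  assumes "E > 0"
  shows "deriv (ignition c E) x = (if x \<le> c then 0 else E / (x - c)\<^sup>2 * exp (- E / (x - c)))"
  using DERIV_imp_deriv[OF flat_function_DERIV[OF assms, of c 1 x]]
  by (simp add: ignition_eq_flat_function flat_function_def field_simps power2_eq_square pderiv_1)

text \<open>
With \<open>t = E / (x - c)\<close> the derivative is \<open>t\<^sup>2 exp (- t) / E\<close>, and \<open>exp t \<ge> t\<^sup>2 / 2\<close>. The upper bound is what makes
the suprema \<open>L\<close> and \<open>M\<close> of the theorem finite.
\<close>

lemma deriv_ignition_bounds:
  assumes "E > 0"
  shows "0 \<le> deriv (ignition c E) x" "deriv (ignition c E) x \<le> 2 / E"
proof -
  show "0 \<le> deriv (ignition c E) x" using assms by (simp add: deriv_ignition)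
  show "deriv (ignition c E) x \<le> 2 / E"
  proof (cases "x \<le> c")
    case False
    define t where "t = E / (x - c)"
    have t: "t > 0" using False assms by (simp add: t_def)
    have "t\<^sup>2 / 2 \<le> exp t" using exp_lower_Taylor_quadratic[of t] t by simp
    then have "t\<^sup>2 * exp (- t) \<le> 2" by (simp add: exp_minus field_simps)
    then have "t\<^sup>2 / E * exp (- t) \<le> 2 / E" using assms by (simp add: field_simps)
    moreover have "t\<^sup>2 / E * exp (- t) = E / (x - c)\<^sup>2 * exp (- E / (x - c))"
      using False assms by (simp add: t_def power_divide) (simp add: power2_eq_square)
    ultimately show ?thesis using False by (simp add: deriv_ignition[OF assms])
  qed (use assms in \<open>simp add: deriv_ignition\<close>)
qed

lemma ignition_bounds:
  assumes "E > 0" shows "0 \<le> ignition c E x" "ignition c E x \<le> 1"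
  using assms by (auto simp: ignition_def)

text \<open>
Smooth approximations of the indicator function of an open interval: an ignition function that switches on at \<open>a\<close>,
times a reflected one that switches off at \<open>b\<close>. As the activation energy \<open>1 / (n + 1)\<close> tends to 0, each factor tends
to a jump, so no normalising constants are needed.
\<close>

definition plateau :: "real \<Rightarrow> real \<Rightarrow> nat \<Rightarrow> real \<Rightarrow> real" where
  "plateau a b n x = ignition a (1 / Suc n) x * ignition (- b) (1 / Suc n) (- x)"

lemma plateau_smooth: "smooth (plateau a b n)"
  unfolding plateau_def by (intro smooth_mult smooth_reflect ignition_smooth) (simp_all del: of_nat_Suc)

lemma plateau_bounds: "0 \<le> plateau a b n x" "plateau a b n x \<le> 1"
  unfolding plateau_def by (simp_all add: mult_le_one ignition_bounds del: of_nat_Suc)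

lemma plateau_eq_0: "x \<notin> {a..b} \<Longrightarrow> plateau a b n x = 0"
  by (auto simp: plateau_def ignition_def)

lemma plateau_tendsto:
  "(\<lambda>n. plateau a b n x) \<longlonglongrightarrow> indicator {a<..<b} x"
proof (cases "x \<in> {a<..<b}")
  case True
  have E: "(\<lambda>n. ignition c (1 / Suc n) y) \<longlonglongrightarrow> 1" if "c < y" for c y
  proof -
    have "(\<lambda>n. exp (- (1 / Suc n) / (y - c))) \<longlonglongrightarrow> exp (- 0 / (y - c))"
      by (intro tendsto_intros LIMSEQ_Suc lim_1_over_n) (use that in auto)
    then show ?thesis using that by (simp add: ignition_def)
  qed
  have "(\<lambda>n. plateau a b n x) \<longlonglongrightarrow> 1 * 1"
    unfolding plateau_def by (intro tendsto_mult E) (use True in auto)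
  then show ?thesis using True by simp
next
  case False
  then show ?thesis by (auto simp: plateau_def ignition_def indicator_def)
qed

section \<open>Indefinite integrals and the product rule\<close>

text \<open>
The fundamental theorem of calculus taken as a definition: \<open>F\<close> is a locally absolutely continuous function
with derivative \<open>f\<close>.
\<close>

definition primitive_of :: "(real \<Rightarrow> complex) \<Rightarrow> (real \<Rightarrow> complex) \<Rightarrow> bool" where
  "primitive_of f F \<longleftrightarrow>
     (\<forall>a b. f absolutely_integrable_on {a..b}) \<and> (\<forall>a b. a \<le> b \<longrightarrow> F b - F a = integral {a..b} f)"

lemma primitive_of_abs_integrable: "primitive_of f F \<Longrightarrow> f absolutely_integrable_on {a..b}"
  and primitive_of_integrable: "primitive_of f F \<Longrightarrow> f integrable_on {a..b}"
  and primitive_of_integral: "primitive_of f F \<Longrightarrow> a \<le> b \<Longrightarrow> integral {a..b} f = F b - F a"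
  unfolding primitive_of_def absolutely_integrable_on_def by metis+

lemma primitive_of_continuous:
  assumes "primitive_of f F" shows "continuous_on S F"
proof -
  have "isCont F x" for x
  proof -
    have "continuous_on {x-1..x+1} (\<lambda>y. integral {x-1..y} f)"
      by (intro indefinite_integral_continuous_1 primitive_of_integrable[OF assms])
    then have "continuous_on {x-1..x+1} (\<lambda>y. F (x-1) + integral {x-1..y} f)"
      by (intro continuous_intros)
    moreover have "F (x-1) + integral {x-1..y} f = F y" if "y \<in> {x-1..x+1}" for y
      using that by (simp add: primitive_of_integral[OF assms])
    ultimately have "continuous_on {x-1..x+1} F" by (rule continuous_on_eq)
    then show ?thesis by (rule continuous_on_interior) (simp add: interior_atLeastAtMost_real)
  qed
  then show ?thesis by (simp add: continuous_at_imp_continuous_on)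
qed

lemma primitive_of_exists:
  assumes "\<And>a b. f absolutely_integrable_on {a..b}"
  obtains F where "primitive_of f F"
proof
  let ?F = "\<lambda>x. if 0 \<le> x then integral {0..x} f else - integral {x..0} f"
  have int: "f integrable_on {a..b}" for a b
    using assms absolutely_integrable_on_def by blast
  show "primitive_of f ?F"
    unfolding primitive_of_def
  proof (intro conjI allI impI assms)
    fix a b :: real assume "a \<le> b"
    then show "?F b - ?F a = integral {a..b} f"
      using Henstock_Kurzweil_Integration.integral_combine[OF _ _ int, of 0 a b] Henstock_Kurzweil_Integration.integral_combine[OF _ _ int, of a 0 b]
        Henstock_Kurzweil_Integration.integral_combine[OF _ _ int, of a b 0]
      by (auto simp: algebra_simps)
  qed
qed

lemma continuous_mult_abs_integrable:
  fixes f G :: "real \<Rightarrow> complex"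
  assumes "f absolutely_integrable_on {a..b}" "continuous_on {a..b} G"
  shows "(\<lambda>x. f x * G x) absolutely_integrable_on {a..b}"
proof (rule absolutely_integrable_bounded_measurable_product[where h = "\<lambda>x y. y * x", of G "{a..b}" f])
  show "bilinear (\<lambda>x y :: complex. y * x)"
    by (auto simp: bilinear_def intro!: linearI simp: algebra_simps)
  show "G \<in> borel_measurable (lebesgue_on {a..b})"
    by (rule continuous_imp_measurable_on_sets_lebesgue) (use assms in auto)
  show "bounded (G ` {a..b})"
    using assms(2) by (intro compact_imp_bounded compact_continuous_image) auto
qed (use assms in auto)

text \<open>
The integrand \<open>f\<close> is only integrable, so \<open>F\<close> need not be differentiable everywhere and the classical fundamental theorem does not
apply. On a short interval from \<open>x\<close> to \<open>y\<close>, the identity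
\<open>F y G y - F x G x = (F y - F x) G y + F x (G y - G x)\<close> shows that the defect \<open>R x y\<close> in the product rule is at most the
oscillation of \<open>F\<close> and \<open>G\<close> times \<open>V x y\<close>, the integral of \<open>\<bar>f\<bar> + \<bar>g\<bar>\<close>. Both \<open>R\<close> and \<open>V\<close> are additive over adjacent
intervals, so by uniform continuity the defect over a fixed interval is arbitrarily small.
\<close>

lemma primitive_of_mult:
  assumes f: "primitive_of f F" and g: "primitive_of g G"
  shows "primitive_of (\<lambda>x. f x * G x + g x * F x) (\<lambda>x. F x * G x)"
proof -
  let ?p = "\<lambda>x. f x * G x + g x * F x"
  have p: "?p absolutely_integrable_on {a..b}" for a b
    by (intro set_integral_add continuous_mult_abs_integrable primitive_of_abs_integrable[OF f]
        primitive_of_abs_integrable[OF g] primitive_of_continuous[OF f] primitive_of_continuous[OF g])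
  then have pint: "?p integrable_on {a..b}" for a b
    using absolutely_integrable_on_def by blast
  define V where "V x y = integral {x..y} (\<lambda>t. norm (f t) + norm (g t))" for x y
  define R where "R x y = F y * G y - F x * G x - integral {x..y} ?p" for x y
  have vint: "(\<lambda>t. norm (f t) + norm (g t)) integrable_on {x..y}" for x y
    using primitive_of_abs_integrable[OF f] primitive_of_abs_integrable[OF g]
    by (intro integrable_add) (auto simp: absolutely_integrable_on_def)
  have V_add: "V x y + V y z = V x z" if "x \<le> y" "y \<le> z" for x y z
    unfolding V_def using that vint by (intro Henstock_Kurzweil_Integration.integral_combine)
  have R_add: "R x y + R y z = R x z" if "x \<le> y" "y \<le> z" for x y z
    unfolding R_def using Henstock_Kurzweil_Integration.integral_combine[OF that pint] by (simp add: algebra_simps)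
  have "F b * G b - F a * G a = integral {a..b} ?p" if "a \<le> b" for a b
  proof -
    have "norm (R a b) \<le> e" if "e > 0" for e
    proof -
      \<comment> \<open>the added 1 keeps the quotient meaningful when \<open>V a b = 0\<close>\<close>
      define e' where "e' = e / (V a b + 1)"
      have V0: "0 \<le> V a b" unfolding V_def by (intro integral_nonneg vint) auto
      then have e': "e' > 0" "e' * V a b \<le> e" using \<open>e > 0\<close> by (auto simp: e'_def field_simps)
      have "uniformly_continuous_on {a..b} F" "uniformly_continuous_on {a..b} G"
        by (auto intro!: compact_uniformly_continuous primitive_of_continuous[OF f] primitive_of_continuous[OF g])
      then obtain d1 d2 where d: "d1 > 0" "d2 > 0"
        "\<And>x y. x \<in> {a..b} \<Longrightarrow> y \<in> {a..b} \<Longrightarrow> dist y x < d1 \<Longrightarrow> dist (F y) (F x) < e'"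
        "\<And>x y. x \<in> {a..b} \<Longrightarrow> y \<in> {a..b} \<Longrightarrow> dist y x < d2 \<Longrightarrow> dist (G y) (G x) < e'"
        unfolding uniformly_continuous_on_def using e'(1) by metis
      define d where "d = min d1 d2 / 2"
      have d0: "d > 0" using d by (simp add: d_def)
      have small: "norm (R x y) \<le> e' * V x y" if "a \<le> x" "x \<le> y" "y \<le> b" "y - x \<le> d" for x y
      proof -
        let ?r = "\<lambda>t. f t * (G y - G t) + g t * (F x - F t)"
        have i1: "(\<lambda>t. f t * G y + g t * F x) integrable_on {x..y}"
          using primitive_of_integrable[OF f] primitive_of_integrable[OF g]
          by (intro integrable_add integrable_on_mult_left)
        have "integral {x..y} (\<lambda>t. f t * G y + g t * F x)
            = (F y - F x) * G y + (G y - G x) * F x"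
          using primitive_of_integrable[OF f] primitive_of_integrable[OF g] that
          by (subst integral_add)
            (auto simp: primitive_of_integral[OF f] primitive_of_integral[OF g] intro!: integrable_on_mult_left)
        then have "R x y = integral {x..y} (\<lambda>t. f t * G y + g t * F x) - integral {x..y} ?p"
          by (simp add: R_def algebra_simps)
        also have "\<dots> = integral {x..y} ?r"
          by (subst integral_diff[OF i1 pint, symmetric]) (simp add: algebra_simps)
        finally have eq: "R x y = integral {x..y} ?r" .
        have "norm (integral {x..y} ?r) \<le> integral {x..y} (\<lambda>t. e' * (norm (f t) + norm (g t)))"
        proof (rule integral_norm_bound_integral)
          have "(\<lambda>t. (f t * G y + g t * F x) - ?p t) integrable_on {x..y}"
            by (rule integrable_diff[OF i1 pint])
          then show "?r integrable_on {x..y}" by (simp add: algebra_simps)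
          show "(\<lambda>t. e' * (norm (f t) + norm (g t))) integrable_on {x..y}"
            using vint by (rule integrable_on_mult_right)
          show "norm (?r t) \<le> e' * (norm (f t) + norm (g t))" if t: "t \<in> {x..y}" for t
          proof -
            have "norm (G y - G t) \<le> e'" "norm (F x - F t) \<le> e'"
              using d(3)[of t x] d(4)[of t y] t \<open>a \<le> x\<close> \<open>y \<le> b\<close> \<open>y - x \<le> d\<close> d0
              by (auto simp: dist_norm dist_real_def d_def)
            then have "norm (f t) * norm (G y - G t) + norm (g t) * norm (F x - F t)
                \<le> norm (f t) * e' + norm (g t) * e'"
              by (intro add_mono mult_left_mono) auto
            then show ?thesis
              by (intro order.trans[OF norm_triangle_ineq]) (simp add: norm_mult distrib_left mult.commute)
          qed
        qed
        then show ?thesis by (simp add: eq V_def)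
      qed
      \<comment> \<open>chain the short intervals: each induction step splits off an initial piece of length at most \<open>d\<close>\<close>
      have "norm (R x y) \<le> e' * V x y" if "a \<le> x" "x \<le> y" "y \<le> b" "y - x \<le> real n * d" for x y n
        using that
      proof (induction n arbitrary: x)
        case 0
        then show ?case using small[of x y] d0 by simp
      next
        case (Suc n)
        define m where "m = min y (x + d)"
        have "norm (R x m) \<le> e' * V x m"
          using Suc.prems d0 by (intro small) (auto simp: m_def)
        moreover have "norm (R m y) \<le> e' * V m y"
        proof (rule Suc.IH)
          show "y - m \<le> real n * d"
            using Suc.prems d0 by (cases "y \<le> x + d") (auto simp: m_def algebra_simps)
        qed (use Suc.prems d0 in \<open>auto simp: m_def\<close>)
        moreover have "R x y = R x m + R m y" "V x y = V x m + V m y"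
          using Suc.prems d0 by (auto simp: m_def intro!: R_add[symmetric] V_add[symmetric])
        ultimately show ?case
          using norm_triangle_ineq[of "R x m" "R m y"] by (simp add: distrib_left)
      qed
      moreover obtain n where "b - a \<le> real n * d"
        using d0 reals_Archimedean3 less_imp_le by blast
      ultimately have "norm (R a b) \<le> e' * V a b" using \<open>a \<le> b\<close> by blast
      with e'(2) show ?thesis by linarith
    qed
    then have "norm (R a b) \<le> 0" by (metis field_le_epsilon add_0)
    then show ?thesis by (simp add: R_def)
  qed
  with p show ?thesis by (simp add: primitive_of_def)
qed

lemma primitive_of_smooth:
  assumes "smooth f"
  shows "primitive_of (\<lambda>x. of_real (deriv f x)) (\<lambda>x. of_real (f x))"
  unfolding primitive_of_def
proof (intro conjI allI impI)
  show "(\<lambda>x. complex_of_real (deriv f x)) absolutely_integrable_on {a..b}" for a b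
    by (intro absolutely_integrable_continuous_real continuous_intros smooth_continuous_on
        smooth_deriv assms)
  fix a b :: real assume "a \<le> b"
  have "((\<lambda>x. complex_of_real (deriv f x)) has_integral (of_real (f b) - of_real (f a))) {a..b}"
    by (intro fundamental_theorem_of_calculus \<open>a \<le> b\<close>)
      (metis has_real_derivative_iff_has_vector_derivative has_vector_derivative_of_real smooth_DERIV' assms)
  then show "complex_of_real (f b) - complex_of_real (f a) = integral {a..b} (\<lambda>x. complex_of_real (deriv f x))"
    by (simp add: integral_unique)
qed

text \<open>
Lebesgue measure is the completion of a \<open>\<sigma>\<close>-finite measure, and a countable exhaustion by sets of finite measure
survives completion. This is needed for uniqueness of densities.
\<close>

lemma sigma_finite_lebesgue: "sigma_finite_measure (lebesgue :: real measure)"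
proof -
  from lborel.sigma_finite_countable obtain A :: "real set set"
    where "countable A" "A \<subseteq> sets lborel" "\<Union>A = space lborel" "\<forall>a\<in>A. emeasure lborel a \<noteq> \<infinity>"
    by blast
  then show ?thesis
    by (intro sigma_finite_measure.intro exI[of _ A])
      (auto simp: subset_eq emeasure_completion)
qed

text \<open>
The closed intervals are an intersection-stable generator of the Borel sets, so the integral of \<open>h\<close>, cut off to a
bounded interval to make it integrable, vanishes over all Borel sets; Lebesgue sets differ from these by null sets only.
Hence \<open>h\<close> has the same density as 0.
\<close>

lemma integrals_zero_imp_AE_zero:
  fixes h :: "real \<Rightarrow> complex"
  assumes abs: "\<And>a b. h absolutely_integrable_on {a..b}"
    and zero: "\<And>a b. a \<le> b \<Longrightarrow> integral {a..b} h = 0"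
  shows "AE x in lebesgue. h x = 0"
proof -
  have loc: "AE x in lebesgue. indicator {- real N..real N} x *\<^sub>R h x = 0" for N :: nat
  proof -
    define k where "k = (\<lambda>x. indicator {- real N..real N} x *\<^sub>R h x)"
    have k: "integrable lebesgue k"
      using abs[of "- real N" "real N"] by (simp add: k_def set_integrable_def)
    have kA: "set_integrable lebesgue A k" if "A \<in> sets lebesgue" for A
      unfolding set_integrable_def using that k by (rule integrable_mult_indicator)
    have cbox: "(LINT x:{a..b}|lebesgue. k x) = 0" for a b
    proof -
      have "(LINT x:{a..b}|lebesgue. k x) = (LINT x:{max a (- real N)..min b (real N)}|lebesgue. h x)"
        unfolding set_lebesgue_integral_def k_def
        by (intro Bochner_Integration.integral_cong) (auto simp: indicator_def)
      also have "\<dots> = integral {max a (- real N)..min b (real N)} h"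
        by (rule set_lebesgue_integral_eq_integral(2)) (rule abs)
      also have "\<dots> = 0"
        by (cases "max a (- real N) \<le> min b (real N)") (simp_all add: zero)
      finally show ?thesis .
    qed
    let ?G = "range (\<lambda>(a, b). {a..b::real})"
    have borel: "sets borel = sigma_sets UNIV ?G"
      by (metis borel_eq_atLeastAtMost sets_measure_of top_greatest Pow_UNIV)
    have B0: "(LINT x:B|lebesgue. k x) = 0" if "B \<in> sets borel" for B
      using that[unfolded borel]
    proof (induction rule: sigma_sets_induct_disjoint[rotated 2, consumes 1, case_names basic empty compl union])
      case (basic A)
      then show ?case using cbox by auto
    next
      case empty
      show ?case by (simp add: set_lebesgue_integral_def)
    next
      case (compl A)
      then have A: "A \<in> sets lebesgue" unfolding borel[symmetric] by simp
      have "(LINT x:(A \<union> (UNIV - A))|lebesgue. k x) = (LINT x:A|lebesgue. k x) + (LINT x:UNIV - A|lebesgue. k x)"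
        using A by (intro set_integral_Un kA) auto
      moreover have "(LINT x:(A \<union> (UNIV - A))|lebesgue. k x) = (LINT x:{- real N..real N}|lebesgue. k x)"
        unfolding set_lebesgue_integral_def k_def
        by (intro Bochner_Integration.integral_cong) (auto simp: indicator_def)
      ultimately show ?case using compl cbox by simp
    next
      case (union A)
      then have "A i \<in> sets lebesgue" for i unfolding borel[symmetric] by (auto simp: subset_iff)
      then have "(LINT x:(\<Union>i. A i)|lebesgue. k x) = (\<Sum>i. (LINT x:(A i)|lebesgue. k x))"
        using union by (intro lebesgue_integral_countable_add kA)
          (auto simp: disjoint_family_on_def)
      then show ?case using union by simp
    next
      show "Int_stable ?G" by (auto simp: Int_stable_def)
    qed simp
    have "AE x in lebesgue. k x = 0"
    proof (rule sigma_finite_measure.density_unique_banach[OF sigma_finite_lebesgue k, of "\<lambda>x. 0"])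
      fix A :: "real set" assume "A \<in> sets lebesgue"
      then obtain S N N' where A: "A = S \<union> N" "N \<subseteq> N'" "N' \<in> null_sets lborel" "S \<in> sets lborel"
        by (rule sets_completionE)
      then have N': "N' \<in> null_sets lebesgue" by (simp add: null_sets_completionI)
      have "(LINT x:A|lebesgue. k x) = (LINT x:S|lebesgue. k x)"
        unfolding set_lebesgue_integral_def
      proof (rule integral_cong_AE)
        show "AE x in lebesgue. indicat_real A x *\<^sub>R k x = indicat_real S x *\<^sub>R k x"
          using AE_not_in[OF N'] by eventually_elim (use A in \<open>auto simp: indicator_def\<close>)
        show "(\<lambda>x. indicat_real A x *\<^sub>R k x) \<in> borel_measurable lebesgue"
             "(\<lambda>x. indicat_real S x *\<^sub>R k x) \<in> borel_measurable lebesgue"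
          using \<open>A \<in> sets lebesgue\<close> A(4) k by (auto intro!: borel_measurable_integrable kA[unfolded set_integrable_def])
      qed
      then show "(LINT x:A|lebesgue. k x) = (LINT x:A|lebesgue. 0)"
        using B0[of S] A(4) by (simp add: set_lebesgue_integral_def)
    qed simp
    then show ?thesis by (simp add: k_def)
  qed
  have "AE x in lebesgue. \<forall>N::nat. indicator {- real N..real N} x *\<^sub>R h x = 0"
    unfolding AE_all_countable using loc by blast
  then show ?thesis
  proof eventually_elim
    case (elim x)
    obtain N :: nat where "\<bar>x\<bar> \<le> real N" using real_arch_simple by blast
    with elim show ?case by (auto dest!: spec[of _ N] simp: indicator_def split: if_splits)
  qed
qed

section \<open>The du Bois-Reymond lemma\<close>

lemma test_functionI:
  assumes "smooth f" "\<And>x. x \<notin> {a..b} \<Longrightarrow> f x = 0"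
  shows "test_function f"
proof -
  have "{x. f x \<noteq> 0} \<subseteq> {a..b}" using assms(2) by blast
  then have "bounded {x. f x \<noteq> 0}" by (rule bounded_subset[OF bounded_closed_interval])
  with assms(1) show ?thesis by (simp add: test_function_def compact_closure)
qed

lemma test_function_support:
  assumes "test_function f"
  obtains r where "r > 0" "\<And>x. r \<le> \<bar>x\<bar> \<Longrightarrow> f x = 0" "\<And>x. r \<le> \<bar>x\<bar> \<Longrightarrow> deriv f x = 0"
proof -
  have "bounded {x. f x \<noteq> 0}"
    using assms compact_imp_bounded bounded_subset closure_subset unfolding test_function_def by metis
  then obtain s where s: "s > 0" "\<And>x. f x \<noteq> 0 \<Longrightarrow> \<bar>x\<bar> \<le> s"
    unfolding bounded_pos by auto
  show thesis
  proof (rule that[of "s + 1"])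
    show "deriv f x = 0" if "s + 1 \<le> \<bar>x\<bar>" for x
    proof -
      have "eventually (\<lambda>y. y \<in> {y. s < \<bar>y\<bar>}) (nhds x)"
        using that by (intro eventually_nhds_in_open open_Collect_less continuous_intros) auto
      then have "eventually (\<lambda>y. f y = 0) (nhds x)"
        by eventually_elim (use s(2) in force)
      then have "deriv f x = deriv (\<lambda>y. 0) x" by (rule deriv_cong_ev) simp
      then show ?thesis by simp
    qed
  qed (use s in force)+
qed

text \<open>
An antiderivative of \<open>\<theta>\<close> is constant on either side of the support, and the two constants agree exactly when the mean is
zero; subtracting the constant gives compact support.
\<close>

lemma mean_zero_has_test_primitive:
  assumes \<theta>: "smooth \<theta>" and supp: "\<And>x. x \<notin> {a..b} \<Longrightarrow> \<theta> x = 0" and "a \<le> b"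
    and zero: "integral {a..b} \<theta> = 0"
  obtains \<psi> where "test_function \<psi>" "deriv \<psi> = \<theta>"
proof -
  have "isCont \<theta> x" for x
    using smooth_DERIV[OF \<theta>] DERIV_isCont by blast
  then have "\<exists>F. \<forall>x. -\<infinity> < ereal x \<longrightarrow> ereal x < \<infinity> \<longrightarrow> (F has_vector_derivative \<theta> x) (at x)"
    by (intro einterval_antiderivative) auto
  then obtain F where F: "\<And>x. (F has_real_derivative \<theta> x) (at x)"
    by (auto simp: has_real_derivative_iff_has_vector_derivative)
  define \<psi> where "\<psi> x = F x - F a" for x
  have \<psi>: "(\<psi> has_real_derivative \<theta> x) (at x)" for x
    unfolding \<psi>_def using F by (auto intro!: derivative_eq_intros)
  have "(\<theta> has_integral (\<psi> b - \<psi> a)) {a..b}"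
    using \<psi> \<open>a \<le> b\<close> by (intro fundamental_theorem_of_calculus)
      (auto simp: has_real_derivative_iff_has_vector_derivative[symmetric] intro: DERIV_subset)
  then have ends: "\<psi> a = 0" "\<psi> b = 0"
    using zero by (simp_all add: integral_unique \<psi>_def)
  have cont: "continuous_on S \<psi>" for S
    using \<psi> DERIV_isCont continuous_at_imp_continuous_on by blast
  have flat: "(\<psi> has_real_derivative 0) (at x)" if "x \<notin> {a..b}" for x
    using \<psi>[of x] supp[OF that] by simp
  have "\<psi> x = 0" if "x \<notin> {a..b}" for x
  proof (cases "x < a")
    case True
    have "\<psi> a = \<psi> x"
      by (rule DERIV_isconst_end[OF True cont]) (auto intro: flat)
    then show ?thesis using ends by simp
  next
    case False
    then have "b < x" using that by auto
    have "\<psi> x = \<psi> b"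
      by (rule DERIV_isconst_end[OF \<open>b < x\<close> cont]) (auto intro: flat)
    then show ?thesis using ends by simp
  qed
  then have "test_function \<psi>"
    using smooth_if_deriv_smooth[OF \<psi> \<theta>] by (intro test_functionI)
  moreover have "deriv \<psi> = \<theta>"
    using \<psi> by (intro ext DERIV_imp_deriv)
  ultimately show thesis using that by blast
qed

lemma LINT_eq_integral_support:
  fixes f :: "real \<Rightarrow> complex"
  assumes "f absolutely_integrable_on {a..b}" "\<And>x. x \<notin> {a..b} \<Longrightarrow> f x = 0"
  shows "integrable lebesgue f" "(LINT x|lebesgue. f x) = integral {a..b} f"
proof -
  have eq: "(\<lambda>x. indicator {a..b} x *\<^sub>R f x) = f"
    using assms(2) by (auto simp: indicator_def fun_eq_iff)
  show "integrable lebesgue f"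
    using assms(1) by (simp add: set_integrable_def eq)
  show "(LINT x|lebesgue. f x) = integral {a..b} f"
    using set_lebesgue_integral_eq_integral(2)[OF assms(1)] by (simp add: set_lebesgue_integral_def eq)
qed

lemma smooth_scaleR_abs_integrable:
  fixes h :: "real \<Rightarrow> complex"
  assumes "smooth \<theta>" "h absolutely_integrable_on {a..b}"
  shows "(\<lambda>x. \<theta> x *\<^sub>R h x) absolutely_integrable_on {a..b}"
  using continuous_mult_abs_integrable[OF assms(2), of "\<lambda>x. of_real (\<theta> x)"] smooth_continuous_on[OF assms(1)]
  by (simp add: scaleR_conv_of_real mult.commute continuous_on_of_real)

lemma plateau_integral_tendsto:
  fixes h :: "real \<Rightarrow> complex"
  assumes abs: "h absolutely_integrable_on {a..b}"
  shows "(\<lambda>n. LINT x|lebesgue. plateau a b n x *\<^sub>R h x) \<longlonglongrightarrow> integral {a..b} h"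
proof -
  have "(\<lambda>n. LINT x|lebesgue. plateau a b n x *\<^sub>R h x)
      \<longlonglongrightarrow> (LINT x|lebesgue. indicator {a<..<b} x *\<^sub>R h x)"
  proof (rule integral_dominated_convergence)
    have "set_integrable lebesgue {a<..<b} h"
      by (rule set_integrable_subset[OF abs]) auto
    then show "(\<lambda>x. indicator {a<..<b} x *\<^sub>R h x) \<in> borel_measurable lebesgue"
      by (simp add: set_integrable_def borel_measurable_integrable)
    show "(\<lambda>x. plateau a b n x *\<^sub>R h x) \<in> borel_measurable lebesgue" for n
      by (rule borel_measurable_integrable, rule LINT_eq_integral_support(1)[where a = a and b = b],
          rule smooth_scaleR_abs_integrable[OF plateau_smooth abs]) (simp add: plateau_eq_0)
    show "integrable lebesgue (\<lambda>x. norm (indicator {a..b} x *\<^sub>R h x))"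
      using abs unfolding set_integrable_def by (rule integrable_norm)
    show "AE x in lebesgue. (\<lambda>n. plateau a b n x *\<^sub>R h x) \<longlonglongrightarrow> indicator {a<..<b} x *\<^sub>R h x"
      by (intro AE_I2 tendsto_scaleR plateau_tendsto tendsto_const)
    show "AE x in lebesgue. norm (plateau a b n x *\<^sub>R h x) \<le> norm (indicator {a..b} x *\<^sub>R h x)" for n
    proof (rule AE_I2)
      fix x show "norm (plateau a b n x *\<^sub>R h x) \<le> norm (indicator {a..b} x *\<^sub>R h x)"
        using plateau_bounds[of a b n x] plateau_eq_0[of x a b n]
        by (cases "x \<in> {a..b}") (auto intro: mult_left_le_one_le)
    qed
  qed
  also have "(LINT x|lebesgue. indicator {a<..<b} x *\<^sub>R h x) = integral {a<..<b} h"
    using set_lebesgue_integral_eq_integral(2)[OF set_integrable_subset[OF abs, of "{a<..<b}"]]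
    by (simp add: set_lebesgue_integral_def greaterThanLessThan_subseteq_atLeastAtMost_iff)
  also have "\<dots> = integral {a..b} h"
    by (simp add: integral_open_interval_real)
  finally show ?thesis .
qed

text \<open>
Derivatives of test functions are the test functions of mean zero. Hence for two plateau functions the integrals against
\<open>h\<close> are in the ratio of their masses; in the limit, the mean value of \<open>h\<close> is the same over every interval. Comparing
with the unit interval identifies the constant as the integral of \<open>h\<close> over it.
\<close>

lemma du_Bois_Reymond:
  fixes h :: "real \<Rightarrow> complex"
  assumes abs: "\<And>a b. h absolutely_integrable_on {a..b}"
    and weak: "\<And>\<psi>. test_function \<psi> \<Longrightarrow> (LINT x|lebesgue. deriv \<psi> x *\<^sub>R h x) = 0"
  obtains c where "AE x in lebesgue. h x = c"
proof -
  define m where "m a b n = integral {a..b} (plateau a b n)" for a b n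
  have m: "(plateau a b n has_integral m a b n) {A..B}" if "{a..b} \<subseteq> {A..B}" for a b A B n
  proof (rule has_integral_on_superset[OF _ _ that])
    show "(plateau a b n has_integral m a b n) {a..b}"
      unfolding m_def by (intro integrable_integral integrable_continuous_real smooth_continuous_on plateau_smooth)
  qed (simp add: plateau_eq_0)
  have lim_m: "(\<lambda>n. m a b n) \<longlonglongrightarrow> b - a" if "a \<le> b" for a b
  proof -
    have "(LINT x|lebesgue. plateau a b n x *\<^sub>R 1) = complex_of_real (m a b n)" for n
    proof -
      have "(\<lambda>x. plateau a b n x *\<^sub>R (1::complex)) absolutely_integrable_on {a..b}"
        by (intro smooth_scaleR_abs_integrable plateau_smooth absolutely_integrable_continuous_real) auto
      then have "(LINT x|lebesgue. plateau a b n x *\<^sub>R 1) = integral {a..b} (\<lambda>x. plateau a b n x *\<^sub>R (1::complex))"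
        by (intro LINT_eq_integral_support(2)) (simp_all add: plateau_eq_0)
      also have "\<dots> = of_real (m a b n)"
        by (intro integral_unique) (simp add: scaleR_conv_of_real has_integral_of_real m)
      finally show ?thesis .
    qed
    then have "(\<lambda>n. complex_of_real (m a b n)) \<longlonglongrightarrow> integral {a..b} (\<lambda>x. 1)"
      using plateau_integral_tendsto[where h = "\<lambda>x. 1" and a = a and b = b] by (simp add: absolutely_integrable_continuous_real)
    also have "integral {a..b} (\<lambda>x. 1 :: complex) = of_real (b - a)"
      using that by (simp add: scaleR_conv_of_real)
    finally show ?thesis by (simp only: tendsto_of_real_iff)
  qed
  have proportional: "m 0 1 n *\<^sub>R (LINT x|lebesgue. plateau a b n x *\<^sub>R h x)
      = m a b n *\<^sub>R (LINT x|lebesgue. plateau 0 1 n x *\<^sub>R h x)" for a b n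
  proof -
    define A B where "A = min a 0" and "B = max b 1"
    define \<theta> where "\<theta> x = m 0 1 n * plateau a b n x + - m a b n * plateau 0 1 n x" for x
    have "\<theta> x = 0" if "x \<notin> {A..B}" for x
    proof -
      have "x \<notin> {a..b}" "x \<notin> {0..1}" using that by (auto simp: A_def B_def)
      then show ?thesis by (simp add: \<theta>_def plateau_eq_0 del: atLeastAtMost_iff)
    qed
    moreover have "smooth \<theta>"
      unfolding \<theta>_def by (intro smooth_linear_comb plateau_smooth)
    moreover have "(\<theta> has_integral (m 0 1 n * m a b n + - m a b n * m 0 1 n)) {A..B}"
      unfolding \<theta>_def
      by (intro has_integral_add has_integral_mult_right m) (auto simp: A_def B_def)
    then have "integral {A..B} \<theta> = 0" by (simp add: integral_unique)
    moreover have "A \<le> B" by (simp add: A_def B_def)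
    ultimately obtain \<psi> where \<psi>: "test_function \<psi>" "deriv \<psi> = \<theta>"
      using mean_zero_has_test_primitive by metis
    have int: "integrable lebesgue (\<lambda>x. plateau c d n x *\<^sub>R h x)" for c d
      by (rule LINT_eq_integral_support(1)[where a = c and b = d],
          rule smooth_scaleR_abs_integrable[OF plateau_smooth abs]) (simp add: plateau_eq_0)
    have "0 = (LINT x|lebesgue. \<theta> x *\<^sub>R h x)"
      using weak[OF \<psi>(1)] by (simp add: \<psi>(2))
    also have "\<dots> = (LINT x|lebesgue. m 0 1 n *\<^sub>R (plateau a b n x *\<^sub>R h x) - m a b n *\<^sub>R (plateau 0 1 n x *\<^sub>R h x))"
      by (simp add: \<theta>_def algebra_simps)
    also have "\<dots> = m 0 1 n *\<^sub>R (LINT x|lebesgue. plateau a b n x *\<^sub>R h x)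
        - m a b n *\<^sub>R (LINT x|lebesgue. plateau 0 1 n x *\<^sub>R h x)"
      using int by (simp del: scaleR_scaleR)
    finally show ?thesis by simp
  qed
  have int: "integral {a..b} h = (b - a) *\<^sub>R integral {0..1} h" if "a \<le> b" for a b
  proof -
    have "(\<lambda>n. m 0 1 n *\<^sub>R (LINT x|lebesgue. plateau a b n x *\<^sub>R h x)) \<longlonglongrightarrow> (1 - 0) *\<^sub>R integral {a..b} h"
      by (intro tendsto_scaleR lim_m plateau_integral_tendsto abs) simp
    moreover have "(\<lambda>n. m 0 1 n *\<^sub>R (LINT x|lebesgue. plateau a b n x *\<^sub>R h x)) \<longlonglongrightarrow> (b - a) *\<^sub>R integral {0..1} h"
      unfolding proportional by (intro tendsto_scaleR lim_m plateau_integral_tendsto abs that)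
    ultimately show ?thesis using LIMSEQ_unique by fastforce
  qed
  have "AE x in lebesgue. h x - integral {0..1} h = 0"
  proof (rule integrals_zero_imp_AE_zero)
    show "(\<lambda>x. h x - integral {0..1} h) absolutely_integrable_on {a..b}" for a b
      by (rule set_integral_diff(1)[OF abs absolutely_integrable_continuous_real]) auto
    show "integral {a..b} (\<lambda>x. h x - integral {0..1} h) = 0" if "a \<le> b" for a b
    proof -
      have "integral {a..b} (\<lambda>x. h x - integral {0..1} h) = integral {a..b} h - integral {a..b} (\<lambda>x. integral {0..1} h)"
        using abs[of a b] by (intro integral_diff) (auto simp: absolutely_integrable_on_def)
      then show ?thesis using int[OF that] that by simp
    qed
  qed
  then show thesis by (intro that[of "integral {0..1} h"]) simp
qed

section \<open>Integration by parts for functions with square integrable weak derivatives\<close>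

text \<open>
Let \<open>F\<close> be any indefinite integral of \<open>g\<close>. By the product rule \<open>F\<close> has weak derivative \<open>g\<close> too, so the weak derivative of \<open>f - F\<close> vanishes and the
du Bois-Reymond lemma applies; the constant is absorbed into \<open>F\<close>.
\<close>

lemma weak_deriv_imp_primitive:
  assumes "weak_deriv f g"
  obtains F where "primitive_of g F" "AE x in lebesgue. f x = F x"
proof -
  have f: "f absolutely_integrable_on {a..b}" and g: "g absolutely_integrable_on {a..b}" for a b
    using assms by (auto simp: weak_deriv_def)
  from primitive_of_exists[OF g] obtain F where F: "primitive_of g F" by blast
  have Fabs: "F absolutely_integrable_on {a..b}" for a b
    by (intro absolutely_integrable_continuous_real primitive_of_continuous[OF F])
  have "(LINT x|lebesgue. deriv \<psi> x *\<^sub>R (f x - F x)) = 0" if \<psi>: "test_function \<psi>" for \<psi>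
  proof -
    have sm: "smooth \<psi>" using \<psi> by (simp add: test_function_def)
    from test_function_support[OF \<psi>] obtain r where r: "r > 0"
      "\<And>x. r \<le> \<bar>x\<bar> \<Longrightarrow> \<psi> x = 0" "\<And>x. r \<le> \<bar>x\<bar> \<Longrightarrow> deriv \<psi> x = 0" by metis
    have out: "\<psi> x = 0" "deriv \<psi> x = 0" if "x \<notin> {-r..r}" for x
      using that r by auto
    note abs = smooth_scaleR_abs_integrable[OF smooth_deriv[OF sm] f]
      smooth_scaleR_abs_integrable[OF smooth_deriv[OF sm] Fabs] smooth_scaleR_abs_integrable[OF sm g]
    note on_support = LINT_eq_integral_support[where a = "-r" and b = r]
    have "integral {-r..r} (\<lambda>x. deriv \<psi> x *\<^sub>R F x) + integral {-r..r} (\<lambda>x. \<psi> x *\<^sub>R g x)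
        = integral {-r..r} (\<lambda>x. of_real (deriv \<psi> x) * F x + g x * of_real (\<psi> x))"
      using abs[of "-r" r, unfolded absolutely_integrable_on_def]
      by (subst Henstock_Kurzweil_Integration.integral_add[symmetric]) (auto simp: scaleR_conv_of_real mult.commute)
    also have "\<dots> = 0"
      using primitive_of_integral[OF primitive_of_mult[OF primitive_of_smooth[OF sm] F], of "-r" r] r by simp
    finally have "(LINT x|lebesgue. deriv \<psi> x *\<^sub>R F x) + (LINT x|lebesgue. \<psi> x *\<^sub>R g x) = 0"
      using on_support(2)[OF abs(2)] on_support(2)[OF abs(3)] out by simp
    moreover have "(LINT x|lebesgue. deriv \<psi> x *\<^sub>R f x) = - (LINT x|lebesgue. \<psi> x *\<^sub>R g x)"
      using assms \<psi> by (auto simp: weak_deriv_def)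
    moreover have "(LINT x|lebesgue. deriv \<psi> x *\<^sub>R f x - deriv \<psi> x *\<^sub>R F x)
        = (LINT x|lebesgue. deriv \<psi> x *\<^sub>R f x) - (LINT x|lebesgue. deriv \<psi> x *\<^sub>R F x)"
      by (intro Bochner_Integration.integral_diff on_support(1) abs) (simp_all add: out)
    ultimately show ?thesis by (simp add: scaleR_diff_right) (metis add_eq_0_iff2)
  qed
  then obtain c where c: "AE x in lebesgue. f x - F x = c"
    using du_Bois_Reymond[of "\<lambda>x. f x - F x"] f Fabs set_integral_diff(1) by metis
  have "primitive_of g (\<lambda>x. F x + c)"
    using F by (simp add: primitive_of_def)
  moreover have "AE x in lebesgue. f x = F x + c"
    using c by eventually_elim (simp add: algebra_simps)
  ultimately show thesis by (rule that)
qed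

lemma primitive_of_cnj:
  assumes "primitive_of f F" shows "primitive_of (\<lambda>x. cnj (f x)) (\<lambda>x. cnj (F x))"
  unfolding primitive_of_def
proof (intro conjI allI impI)
  show "(\<lambda>x. cnj (f x)) absolutely_integrable_on {a..b}" for a b
    using absolutely_integrable_linear[OF primitive_of_abs_integrable[OF assms] bounded_linear_cnj]
    by (simp add: o_def)
  show "cnj (F b) - cnj (F a) = integral {a..b} (\<lambda>x. cnj (f x))" if "a \<le> b" for a b
    using primitive_of_integral[OF assms that] by (simp flip: integral_cnj)
qed

lemma integral_Icc_le_LINT:
  fixes f :: "real \<Rightarrow> real"
  assumes "integrable lebesgue f" "\<And>x. 0 \<le> f x"
  shows "integral {a..b} f \<le> (LINT x|lebesgue. f x)"
proof -
  have s: "set_integrable lebesgue {a..b} f"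
    unfolding set_integrable_def using assms(1) by (intro integrable_mult_indicator) auto
  have "(LINT x:{a..b}|lebesgue. f x) \<le> (LINT x|lebesgue. f x)"
    unfolding set_lebesgue_integral_def using assms s[unfolded set_integrable_def]
    by (intro integral_mono) (auto simp: indicator_def)
  then show ?thesis using set_lebesgue_integral_eq_integral(2)[OF s] by simp
qed

text \<open>
The integral of \<open>p\<close> over \<open>{-t..t}\<close> is \<open>P t - P (- t)\<close>. If its limit were not 0, then \<open>\<bar>P t\<bar> + \<bar>P (- t)\<bar>\<close> would be
bounded below by a positive number for all large \<open>t\<close>, and \<open>P\<close> would not be integrable.
\<close>

lemma LINT_eq_0_if_primitive_integrable:
  assumes P: "primitive_of p P" and p_int: "integrable lebesgue p" and P_int: "integrable lebesgue P"
  shows "(LINT x|lebesgue. p x) = 0"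
proof (rule ccontr)
  let ?I = "LINT x|lebesgue. p x"
  assume "?I \<noteq> 0"
  define e where "e = norm ?I / 2"
  have e: "e > 0" using \<open>?I \<noteq> 0\<close> by (simp add: e_def)
  have "((\<lambda>t. LINT x|lebesgue. indicator {-t..t} x *\<^sub>R p x) \<longlongrightarrow> ?I) at_top"
  proof (rule integral_dominated_convergence_at_top[where w = "\<lambda>x. norm (p x)"])
    show "AE x in lebesgue. ((\<lambda>t. indicator {-t..t} x *\<^sub>R p x) \<longlongrightarrow> p x) at_top"
    proof (rule AE_I2)
      fix x :: real
      have "eventually (\<lambda>t. indicator {-t..t} x *\<^sub>R p x = p x) at_top"
        using eventually_ge_at_top[of "\<bar>x\<bar>"] by eventually_elim (auto simp: indicator_def)
      then show "((\<lambda>t. indicator {-t..t} x *\<^sub>R p x) \<longlongrightarrow> p x) at_top"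
        by (rule tendsto_eventually)
    qed
    show "(\<lambda>x. indicator {-t..t} x *\<^sub>R p x) \<in> borel_measurable lebesgue" for t
      using p_int by (intro borel_measurable_integrable integrable_mult_indicator) auto
  qed (use p_int in \<open>auto intro!: always_eventually AE_I2 simp: indicator_def\<close>)
  then have "((\<lambda>t. norm (LINT x|lebesgue. indicator {-t..t} x *\<^sub>R p x)) \<longlongrightarrow> norm ?I) at_top"
    by (rule tendsto_norm)
  from order_tendstoD(1)[OF this, of e]
  have "eventually (\<lambda>t. e < norm (LINT x|lebesgue. indicator {-t..t} x *\<^sub>R p x)) at_top"
    using e by (simp add: e_def)
  then obtain N where N: "\<And>t. N \<le> t \<Longrightarrow> e < norm (LINT x|lebesgue. indicator {-t..t} x *\<^sub>R p x)"
    by (auto simp: eventually_at_top_linorder)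
  define N' where "N' = max N 0"
  have low: "e \<le> norm (P t) + norm (P (- t))" if "N' \<le> t" for t
  proof -
    have "(LINT x|lebesgue. indicator {-t..t} x *\<^sub>R p x) = integral {-t..t} p"
      using set_lebesgue_integral_eq_integral(2)[OF primitive_of_abs_integrable[OF P]]
      by (simp add: set_lebesgue_integral_def)
    also have "\<dots> = P t - P (- t)"
      using that by (intro primitive_of_integral[OF P]) (simp add: N'_def)
    finally show ?thesis
      using N[of t] that norm_triangle_ineq4[of "P t" "P (-t)"] by (simp add: N'_def)
  qed
  have cont: "continuous_on S (\<lambda>x. norm (P x))" "continuous_on S (\<lambda>x. norm (P (- x)))" for S
    by (auto intro!: continuous_intros primitive_of_continuous[OF P]
        continuous_on_compose2[OF primitive_of_continuous[OF P, of UNIV]])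
  define K where "K = (LINT x|lebesgue. norm (P x))"
  have "e * m \<le> 2 * K" if "m \<ge> 0" for m
  proof -
    have "e * m = integral {N'..N' + m} (\<lambda>x. e)" using that by simp
    also have "\<dots> \<le> integral {N'..N' + m} (\<lambda>x. norm (P x) + norm (P (- x)))"
      by (intro integral_le integrable_continuous_real continuous_intros cont low) auto
    also have "\<dots> = integral {N'..N' + m} (\<lambda>x. norm (P x)) + integral {N'..N' + m} (\<lambda>x. norm (P (- x)))"
      by (intro Henstock_Kurzweil_Integration.integral_add integrable_continuous_real cont)
    also have "integral {N'..N' + m} (\<lambda>x. norm (P (- x))) = integral {- (N' + m)..- N'} (\<lambda>x. norm (P x))"
      using Henstock_Kurzweil_Integration.integral_reflect_real[of "N' + m" N' "\<lambda>x. norm (P (-x))"] by simp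
    also have "integral {N'..N' + m} (\<lambda>x. norm (P x)) + \<dots> \<le> K + K"
      unfolding K_def using P_int by (intro add_mono integral_Icc_le_LINT) auto
    finally show ?thesis by simp
  qed
  \<comment> \<open>an interval of this length violates the bound\<close>
  from this[of "(2 * \<bar>K\<bar> + 1) / e"] e show False by simp
qed

lemma L2_measurable: "L2 f \<Longrightarrow> f \<in> borel_measurable lebesgue"
  by (simp add: L2_def)

lemma L2_norm_square: "L2 f \<Longrightarrow> integrable lebesgue (\<lambda>x. (norm (f x))\<^sup>2)"
  by (simp add: L2_def)

lemma L2_mult_integrable:
  assumes "L2 f" "L2 g" "h \<in> borel_measurable lebesgue" "\<And>x. norm (h x) \<le> norm (f x) * norm (g x) * C"
  shows "integrable lebesgue (h :: real \<Rightarrow> complex)"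
proof (rule Bochner_Integration.integrable_bound)
  show "integrable lebesgue (\<lambda>x. \<bar>C\<bar> * ((norm (f x))\<^sup>2 + (norm (g x))\<^sup>2))"
    using assms by (intro integrable_mult_right Bochner_Integration.integrable_add L2_norm_square)
  show "AE x in lebesgue. norm (h x) \<le> norm (\<bar>C\<bar> * ((norm (f x))\<^sup>2 + (norm (g x))\<^sup>2))"
  proof (rule AE_I2)
    fix x
    have "norm (f x) * norm (g x) * C \<le> norm (f x) * norm (g x) * \<bar>C\<bar>"
      by (intro mult_left_mono) auto
    also have "norm (f x) * norm (g x) \<le> (norm (f x))\<^sup>2 + (norm (g x))\<^sup>2"
      using sum_squares_bound[of "norm (f x)" "norm (g x)"] mult_nonneg_nonneg[OF norm_ge_zero[of "f x"] norm_ge_zero[of "g x"]]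
      by linarith
    finally show "norm (h x) \<le> norm (\<bar>C\<bar> * ((norm (f x))\<^sup>2 + (norm (g x))\<^sup>2))"
      using assms(4)[of x] by (simp add: mult.commute abs_mult mult_right_mono)
  qed
qed (use assms in auto)

lemma continuous_lebesgue_measurable:
  assumes "continuous_on UNIV f" shows "f \<in> borel_measurable (lebesgue :: real measure)"
  by (rule measurable_completion) (simp add: borel_measurable_continuous_onI assms)

lemma measurable_cnj: "cnj \<in> borel_measurable borel"
  by (intro borel_measurable_continuous_onI continuous_intros)

lemma H1_integration_by_parts:
  assumes f: "L2 f" "L2 f'" "weak_deriv f f'" and g: "L2 g" "L2 g'" "weak_deriv g g'"
  shows "(LINT x|lebesgue. f' x * cnj (g x)) = - (LINT x|lebesgue. f x * cnj (g' x))"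
proof -
  obtain F where F: "primitive_of f' F" "AE x in lebesgue. f x = F x"
    using weak_deriv_imp_primitive[OF f(3)] by blast
  obtain G where G: "primitive_of g' G" "AE x in lebesgue. g x = G x"
    using weak_deriv_imp_primitive[OF g(3)] by blast
  have [measurable]: "f \<in> borel_measurable lebesgue" "f' \<in> borel_measurable lebesgue"
    "g \<in> borel_measurable lebesgue" "g' \<in> borel_measurable lebesgue"
    using f g by (auto simp: L2_def)
  have [measurable]: "F \<in> borel_measurable lebesgue" "G \<in> borel_measurable lebesgue"
    by (intro continuous_lebesgue_measurable primitive_of_continuous[OF F(1)] primitive_of_continuous[OF G(1)])+
  note [measurable] = measurable_cnj
  have i1: "integrable lebesgue (\<lambda>x. f' x * cnj (g x))"
    by (rule L2_mult_integrable[OF f(2) g(1), of _ 1]) (auto simp: norm_mult)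
  have i2: "integrable lebesgue (\<lambda>x. f x * cnj (g' x))"
    by (rule L2_mult_integrable[OF f(1) g(2), of _ 1]) (auto simp: norm_mult)
  have i3: "integrable lebesgue (\<lambda>x. f x * cnj (g x))"
    by (rule L2_mult_integrable[OF f(1) g(1), of _ 1]) (auto simp: norm_mult)
  let ?p = "\<lambda>x. f' x * cnj (G x) + cnj (g' x) * F x"
  have ae: "AE x in lebesgue. f' x * cnj (g x) + f x * cnj (g' x) = ?p x"
    using F(2) G(2) by eventually_elim simp
  have ae': "AE x in lebesgue. f x * cnj (g x) = F x * cnj (G x)"
    using F(2) G(2) by eventually_elim simp
  have "(LINT x|lebesgue. ?p x) = 0"
  proof (rule LINT_eq_0_if_primitive_integrable)
    show "primitive_of ?p (\<lambda>x. F x * cnj (G x))"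
      by (rule primitive_of_mult[OF F(1) primitive_of_cnj[OF G(1)]])
    show "integrable lebesgue ?p"
      by (rule integrable_cong_AE_imp[OF Bochner_Integration.integrable_add[OF i1 i2]])
        (use ae in \<open>auto\<close>)
    show "integrable lebesgue (\<lambda>x. F x * cnj (G x))"
      by (rule integrable_cong_AE_imp[OF i3]) (use ae' in \<open>auto\<close>)
  qed
  moreover have "(LINT x|lebesgue. ?p x) = (LINT x|lebesgue. f' x * cnj (g x) + f x * cnj (g' x))"
    by (rule integral_cong_AE) (use ae in \<open>auto elim: eventually_mono\<close>)
  moreover have "\<dots> = (LINT x|lebesgue. f' x * cnj (g x)) + (LINT x|lebesgue. f x * cnj (g' x))"
    by (rule Bochner_Integration.integral_add[OF i1 i2])
  ultimately show ?thesis by (simp add: eq_neg_iff_add_eq_0)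
qed

section \<open>Bounds on the detonation profile\<close>

text \<open>
If \<open>g\<close> exceeded \<open>c\<close> at \<open>x\<close>, it would have to return to the level \<open>g x\<close> later. Its maximum up to the return
time would then lie at an earlier point where \<open>g\<close> is above \<open>c\<close>, and there \<open>g\<close> is still strictly increasing.
\<close>

lemma le_if_increasing_above:
  fixes g :: "real \<Rightarrow> real"
  assumes der: "\<And>x. (g has_real_derivative g' x) (at x)"
    and lim: "(g \<longlongrightarrow> l) at_top" "l \<le> c"
    and incr: "\<And>x. c < g x \<Longrightarrow> 0 < g' x"
  shows "g x \<le> c"
proof (rule ccontr)
  assume "\<not> g x \<le> c"
  then have gx: "c < g x" by simp
  then have "eventually (\<lambda>y. g y < g x) at_top"
    by (intro order_tendstoD(2)[OF lim(1)]) (use lim(2) in simp)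
  then obtain y where y: "x \<le> y" "g y < g x"
    by (metis eventually_at_top_linorder linorder_linear)
  have "continuous_on {x..y} g"
    using der DERIV_isCont continuous_at_imp_continuous_on by blast
  then obtain m where m: "m \<in> {x..y}" "\<And>t. t \<in> {x..y} \<Longrightarrow> g t \<le> g m"
    using continuous_attains_sup[of "{x..y}" g] y(1) by auto
  have "g x \<le> g m" using m(2)[of x] y(1) by simp
  then have "0 < g' m" "m < y" using gx incr[of m] y m(1) by (auto simp: less_le)
  from DERIV_pos_inc_right[OF der this(1)] obtain d where d: "d > 0"
    "\<And>h. 0 < h \<Longrightarrow> h < d \<Longrightarrow> g m < g (m + h)" by blast
  have "g m < g (m + min (d / 2) (y - m))"
    using d \<open>m < y\<close> by (intro d(2)) auto
  moreover have "g (m + min (d / 2) (y - m)) \<le> g m"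
    using m(1) d(1) \<open>m < y\<close> by (intro m(2)) auto
  ultimately show False by simp
qed

text \<open>
The flux \<open>D z' + z\<close> is nondecreasing with limit 1, and \<open>N\<close> is the first integral of the profile equations. Together they give the
differential inequality \<open>low\<close>, by which \<open>u\<close> increases strictly outside the interval in question. Above the interval this contradicts
the limit \<open>u\<^sub>+\<close> at plus infinity; below it, the limit \<open>u\<^sub>-\<close> at minus infinity, which is the same argument for \<open>- u (- x)\<close>.
\<close>

lemma profile_range:
  assumes "D > 0" "k > 0" and \<phi>: "\<And>v. 0 \<le> \<phi> v"
    and prof: "strong_detonation_profile D k q u_plus u_minus u_ig \<phi> u z"
  shows "u_plus \<le> u x" "u x \<le> 2 - u_plus"
proof -
  have sm: "smooth u" "smooth z" and up: "u_plus < 1" "1 < u_minus" and q: "0 < q"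
    and equ: "\<And>x. - deriv u x + deriv (\<lambda>y. (u y)\<^sup>2 / 2) x = deriv (deriv u) x + q * k * \<phi> (u x) * z x"
    and eqz: "\<And>x. - deriv z x = D * deriv (deriv z) x - k * \<phi> (u x) * z x"
    and z: "\<And>x. 0 \<le> z x"
    and lim: "(u \<longlongrightarrow> u_minus) at_bot" "(u \<longlongrightarrow> u_plus) at_top" "(z \<longlongrightarrow> 1) at_top"
      "(deriv u \<longlongrightarrow> 0) at_top" "(deriv z \<longlongrightarrow> 0) at_top"
    using prof by (auto simp: strong_detonation_profile_def)
  note u1 = smooth_DERIV[OF sm(1)] and u2 = smooth_DERIV[OF smooth_deriv[OF sm(1)]]
    and z1 = smooth_DERIV[OF sm(2)] and z2 = smooth_DERIV[OF smooth_deriv[OF sm(2)]]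
  have sq: "((\<lambda>y. (u y)\<^sup>2 / 2) has_real_derivative u x * deriv u x) (at x)" for x
    by (auto intro!: derivative_eq_intros u1)
  have flux: "((\<lambda>x. D * deriv z x + z x) has_real_derivative k * \<phi> (u x) * z x) (at x)" for x
    using eqz[of x] by (auto intro!: derivative_eq_intros z1 z2 simp: algebra_simps)
  have mono: "mono (\<lambda>x. D * deriv z x + z x)"
  proof (rule monoI)
    fix x y :: real assume "x \<le> y"
    moreover have "0 \<le> k * \<phi> (u t) * z t" for t
      using \<phi> z \<open>k > 0\<close> by simp
    ultimately show "D * deriv z x + z x \<le> D * deriv z y + z y"
      using flux by (intro DERIV_nonneg_imp_nondecreasing[of x y "\<lambda>x. D * deriv z x + z x"]) blast+
  qed
  have lim1: "((\<lambda>x. D * deriv z x + z x) \<longlongrightarrow> D * 0 + 1) at_top"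
    by (intro tendsto_intros lim)
  have flux_le: "D * deriv z x + z x \<le> 1" for x
  proof -
    have "eventually (\<lambda>y. D * deriv z x + z x \<le> D * deriv z y + z y) at_top"
      using eventually_ge_at_top[of x] by eventually_elim (rule monoD[OF mono])
    from tendsto_lowerbound[OF lim1 this] show ?thesis by simp
  qed
  define N where "N x = deriv u x + u x - (u x)\<^sup>2 / 2 + q * (D * deriv z x + z x)" for x
  have "(N has_real_derivative 0) (at x)" for x
  proof -
    have "(N has_real_derivative
        deriv (deriv u) x + deriv u x - u x * deriv u x + q * (k * \<phi> (u x) * z x)) (at x)"
      unfolding N_def by (intro DERIV_add DERIV_diff DERIV_cmult u1 u2 sq flux)
    moreover have "deriv (deriv u) x + deriv u x - u x * deriv u x + q * (k * \<phi> (u x) * z x) = 0"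
      using equ[of x] DERIV_imp_deriv[OF sq] by simp
    ultimately show ?thesis by simp
  qed
  then have N_const: "N x = N y" for x y by (intro DERIV_isconst_all) blast
  have N_lim: "(N \<longlongrightarrow> 0 + u_plus - u_plus\<^sup>2 / 2 + q * (D * 0 + 1)) at_top"
    unfolding N_def by (intro tendsto_intros lim) auto
  have N_eq: "N x = u_plus - u_plus\<^sup>2 / 2 + q" for x
  proof -
    have "(N \<longlongrightarrow> N x) at_top"
      by (intro tendsto_eventually always_eventually allI N_const)
    from tendsto_unique[OF _ this N_lim] show ?thesis by simp
  qed
  have low: "((u x - 1)\<^sup>2 - (1 - u_plus)\<^sup>2) / 2 \<le> deriv u x" for x
  proof -
    have "q * (D * deriv z x + z x) \<le> q" using flux_le[of x] q by simp
    moreover have "((u x - 1)\<^sup>2 - (1 - u_plus)\<^sup>2) / 2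
        = (u x)\<^sup>2 / 2 - u x - (u_plus\<^sup>2 / 2 - u_plus)"
      by (simp add: power2_diff field_simps)
    ultimately show ?thesis using N_eq[of x] unfolding N_def by linarith
  qed
  have pos: "0 < deriv u x" if "1 - u_plus < \<bar>u x - 1\<bar>" for x
  proof -
    have "(1 - u_plus)\<^sup>2 < \<bar>u x - 1\<bar>\<^sup>2" using that up by (intro power_strict_mono) auto
    then show ?thesis using low[of x] by simp
  qed
  show "u x \<le> 2 - u_plus"
  proof (rule le_if_increasing_above[OF u1 lim(2)])
    show "0 < deriv u y" if "2 - u_plus < u y" for y
      using that up by (intro pos) auto
  qed (use up in simp)
  have "- u (- t) \<le> - u_plus" for t
  proof (rule le_if_increasing_above[of "\<lambda>x. - u (- x)" "\<lambda>y. deriv u (- y)" "- u_minus"])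
    show "((\<lambda>x. - u (- x)) has_real_derivative deriv u (- y)) (at y)" for y
      using DERIV_minus[OF DERIV_chain2[OF u1[of "- y"] DERIV_minus[OF DERIV_ident]]] by simp
    show "((\<lambda>x. - u (- x)) \<longlongrightarrow> - u_minus) at_top"
      by (intro tendsto_minus filterlim_compose[OF lim(1)] filterlim_uminus_at_bot_at_top)
    show "0 < deriv u (- y)" if "- u_plus < - u (- y)" for y
      using that up by (intro pos) auto
  qed (use up in simp)
  from this[of "- x"] show "u_plus \<le> u x" by simp
qed

section \<open>Energy estimates\<close>

lemma weighted_L2_mult_integrable:
  assumes "L2 f" "L2 g" "c \<in> borel_measurable lebesgue" "\<And>x. \<bar>c x\<bar> \<le> C"
  shows "integrable lebesgue (\<lambda>x. complex_of_real (c x) * f x * cnj (g x))"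
proof (rule L2_mult_integrable[OF assms(1,2), of _ C])
  note [measurable] = measurable_cnj L2_measurable[OF assms(1)] L2_measurable[OF assms(2)] assms(3)
  show "(\<lambda>x. complex_of_real (c x) * f x * cnj (g x)) \<in> borel_measurable lebesgue"
    by measurable
  show "norm (complex_of_real (c x) * f x * cnj (g x)) \<le> norm (f x) * norm (g x) * C" for x
  proof -
    have "\<bar>c x\<bar> * (norm (f x) * norm (g x)) \<le> C * (norm (f x) * norm (g x))"
      using assms(4) by (intro mult_right_mono) auto
    then show ?thesis by (simp add: norm_mult mult_ac)
  qed
qed

definition L2_sqnorm :: "(real \<Rightarrow> complex) \<Rightarrow> real" where
  "L2_sqnorm f = (LINT x|lebesgue. (norm (f x))\<^sup>2)"

lemma LINT_mult_cnj_self: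
  assumes "L2 f" shows "(LINT x|lebesgue. f x * cnj (f x)) = of_real (L2_sqnorm f)"
  unfolding L2_sqnorm_def using integral_complex_of_real[of lebesgue "\<lambda>x. (norm (f x))\<^sup>2"]
  by (simp only: complex_norm_square)

lemma L2_mult_cnj_integrable:
  assumes "L2 f" "L2 g" shows "integrable lebesgue (\<lambda>x. f x * cnj (g x))"
  using weighted_L2_mult_integrable[OF assms, of "\<lambda>x. 1" 1] by simp

text \<open>
The number \<open>1 \<mp> i\<close> that rotates \<open>lam\<close> so that its real part becomes \<open>Re lam + \<bar>Im lam\<bar>\<close>.
\<close>

definition phase :: "complex \<Rightarrow> complex" where
  "phase lam = Complex 1 (if 0 \<le> Im lam then - 1 else 1)"

lemma phase_mult: "Re (phase lam * lam) = Re lam + \<bar>Im lam\<bar>"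
  by (simp add: phase_def)

lemma norm_phase: "norm (phase lam) = sqrt 2"
  by (simp add: phase_def cmod_def)

lemma Re_phase: "Re (phase lam) = 1"
  by (simp add: phase_def)

lemma Re_phase_le: "Re (phase lam * x) \<le> sqrt 2 * norm x"
  using complex_Re_le_cmod[of "phase lam * x"] by (simp add: norm_mult norm_phase)

lemma sqrt2_mult_le: "sqrt 2 * (a * b) \<le> 2 * a\<^sup>2 + b\<^sup>2 / 4" "sqrt 2 * (a * b) \<le> a\<^sup>2 + b\<^sup>2 / 2" for a b :: real
proof -
  have "0 \<le> (sqrt 2 * a - b / 2)\<^sup>2" by simp
  then show "sqrt 2 * (a * b) \<le> 2 * a\<^sup>2 + b\<^sup>2 / 4" by (simp add: power2_diff power_mult_distrib power_divide)
  have "0 \<le> (sqrt 2 * a - b)\<^sup>2" by simp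
  then show "sqrt 2 * (a * b) \<le> a\<^sup>2 + b\<^sup>2 / 2" by (simp add: power2_diff power_mult_distrib power_divide)
qed

text \<open>
The common last step of both estimates: an identity for \<open>lam\<close> times a squared norm, together with a pointwise bound on the rotated
integrand, bounds \<open>Re lam + \<bar>Im lam\<bar>\<close> times the squared norm.
\<close>

lemma phase_LINT_le:
  assumes T: "integrable lebesgue T" and B: "integrable lebesgue B"
    and eq: "lam * of_real N = (LINT x|lebesgue. T x)"
    and le: "\<And>x. Re (phase lam * T x) \<le> B x"
  shows "(Re lam + \<bar>Im lam\<bar>) * N \<le> (LINT x|lebesgue. B x)"
proof -
  have "(Re lam + \<bar>Im lam\<bar>) * N = Re (phase lam * (lam * of_real N))"
    by (simp only: phase_mult[symmetric]) (simp add: algebra_simps)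
  also have "\<dots> = (LINT x|lebesgue. Re (phase lam * T x))"
    unfolding eq using T by (simp del: times_complex.sel)
  also have "\<dots> \<le> (LINT x|lebesgue. B x)"
    using T B le by (intro integral_mono integrable_Re) auto
  finally show ?thesis .
qed

text \<open>
Test the equation with the conjugate of \<open>w\<close> and move one derivative off \<open>z'\<close> and off \<open>w''\<close>. The latter gives
\<open>- \<bar>w'\<bar>\<^sup>2\<close>, on which the rotation acts with real part 1. Each of the two terms with a factor \<open>w'\<close> may use a quarter of it,
which leaves one half. The constant 4 is the sum of the two contributions \<open>2 \<bar>w\<bar>\<^sup>2\<close> paid to the terms with
coefficients \<open>a\<close> and \<open>b\<close>.
\<close>

lemma energy_estimate_w:
  assumes w: "H2 w w' w''" and z: "H2 z z' z''"
    and a: "a \<in> borel_measurable lebesgue" "\<And>x. \<bar>a x\<bar> \<le> 1"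
    and b: "b \<in> borel_measurable lebesgue" "\<And>x. \<bar>b x\<bar> \<le> 1"
    and c: "\<bar>c\<bar> \<le> d / 2"
    and eq: "AE x in lebesgue. lam * w x = of_real (a x) * w' x + of_real (b x) * z x + of_real c * z' x + w'' x"
  shows "(Re lam + \<bar>Im lam\<bar>) * L2_sqnorm w + L2_sqnorm w' / 2 \<le> 4 * L2_sqnorm w + (1/4 + d\<^sup>2 / 2) * L2_sqnorm z"
proof -
  have L: "L2 w" "L2 w'" "L2 w''" "L2 z" "L2 z'" "L2 z''" "weak_deriv w w'" "weak_deriv w' w''" "weak_deriv z z'"
    using w z by (auto simp: H2_def)
  define T0 where "T0 x = of_real (a x) * w' x * cnj (w x) + of_real (b x) * z x * cnj (w x)" for x
  define T where "T x = T0 x - of_real c * (z x * cnj (w' x)) - w' x * cnj (w' x)" for x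
  have iT0: "integrable lebesgue T0"
    unfolding T0_def using L a b by (intro Bochner_Integration.integrable_add weighted_L2_mult_integrable)
  note i = iT0 L2_mult_cnj_integrable[OF L(4,2)] L2_mult_cnj_integrable[OF L(2,2)]
    L2_mult_cnj_integrable[OF L(5,1)] L2_mult_cnj_integrable[OF L(3,1)] L2_mult_cnj_integrable[OF L(1,1)]
  have iT: "integrable lebesgue T" unfolding T_def using i by simp
  have "lam * of_real (L2_sqnorm w) = (LINT x|lebesgue. lam * (w x * cnj (w x)))"
    using i by (simp add: LINT_mult_cnj_self[OF L(1)])
  also have "\<dots> = (LINT x|lebesgue. T0 x + of_real c * (z' x * cnj (w x)) + w'' x * cnj (w x))"
  proof (rule integral_cong_AE)
    show "AE x in lebesgue. lam * (w x * cnj (w x)) = T0 x + of_real c * (z' x * cnj (w x)) + w'' x * cnj (w x)"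
      using eq by eventually_elim (simp add: T0_def mult.assoc[symmetric] distrib_right)
  qed (use i in \<open>auto intro!: borel_measurable_integrable\<close>)
  also have "\<dots> = (LINT x|lebesgue. T0 x) + of_real c * (LINT x|lebesgue. z' x * cnj (w x)) + (LINT x|lebesgue. w'' x * cnj (w x))"
    using i by simp
  also have "\<dots> = (LINT x|lebesgue. T0 x) - of_real c * (LINT x|lebesgue. z x * cnj (w' x)) - (LINT x|lebesgue. w' x * cnj (w' x))"
    by (simp add: H1_integration_by_parts[OF L(4,5,9) L(1,2,7)] H1_integration_by_parts[OF L(2,3,8) L(1,2,7)])
  also have "\<dots> = (LINT x|lebesgue. T x)"
    unfolding T_def using i by simp
  finally have eqT: "lam * of_real (L2_sqnorm w) = (LINT x|lebesgue. T x)" .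
  define B where "B x = 4 * (norm (w x))\<^sup>2 - (norm (w' x))\<^sup>2 / 2 + (1/4 + d\<^sup>2/2) * (norm (z x))\<^sup>2" for x
  note iB = L2_norm_square[OF L(1)] L2_norm_square[OF L(2)] L2_norm_square[OF L(4)]
  have "(Re lam + \<bar>Im lam\<bar>) * L2_sqnorm w \<le> (LINT x|lebesgue. B x)"
  proof (rule phase_LINT_le[OF iT _ eqT])
    show "integrable lebesgue B" unfolding B_def using iB by simp
    fix x
    have "Re (phase lam * T x) = Re (phase lam * (T0 x - of_real c * (z x * cnj (w' x)))) - (norm (w' x))\<^sup>2"
      using arg_cong[OF complex_norm_square[of "w' x"], of "\<lambda>t. Re (phase lam * t)"]
      by (simp add: T_def right_diff_distrib Re_phase del: times_complex.sel) (simp add: Re_phase)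
    also have "Re (phase lam * (T0 x - of_real c * (z x * cnj (w' x)))) \<le> sqrt 2 * norm (T0 x - of_real c * (z x * cnj (w' x)))"
      by (rule Re_phase_le)
    also have "norm (T0 x - of_real c * (z x * cnj (w' x))) \<le> norm (w x) * norm (w' x) + norm (w x) * norm (z x) + d / 2 * (norm (z x) * norm (w' x))"
    proof -
      have "norm (T0 x) \<le> \<bar>a x\<bar> * (norm (w' x) * norm (w x)) + \<bar>b x\<bar> * (norm (z x) * norm (w x))"
        unfolding T0_def by (rule order.trans[OF norm_triangle_ineq]) (simp add: norm_mult mult.assoc)
      also have "\<dots> \<le> 1 * (norm (w' x) * norm (w x)) + 1 * (norm (z x) * norm (w x))"
        by (intro add_mono mult_right_mono a b) auto
      finally have 1: "norm (T0 x) \<le> \<dots>" .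
      have "norm (of_real c * (z x * cnj (w' x))) \<le> d / 2 * (norm (z x) * norm (w' x))"
        using mult_right_mono[OF c, of "norm (z x) * norm (w' x)"] by (simp add: norm_mult)
      with 1 norm_triangle_ineq4[of "T0 x" "of_real c * (z x * cnj (w' x))"] show ?thesis
        by (simp add: mult.commute)
    qed
    finally have "Re (phase lam * T x) \<le> sqrt 2 * (norm (w x) * norm (w' x)) + sqrt 2 * (norm (w x) * norm (z x))
        + sqrt 2 * ((d / 2 * norm (z x)) * norm (w' x)) - (norm (w' x))\<^sup>2"
      by (simp add: algebra_simps)
    also have "\<dots> \<le> (2 * (norm (w x))\<^sup>2 + (norm (w' x))\<^sup>2 / 4) + (2 * (norm (w x))\<^sup>2 + (norm (z x))\<^sup>2 / 4)
        + (2 * (d / 2 * norm (z x))\<^sup>2 + (norm (w' x))\<^sup>2 / 4) - (norm (w' x))\<^sup>2"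
      by (intro add_mono diff_right_mono sqrt2_mult_le(1))
    also have "\<dots> = B x"
      by (simp add: B_def power_mult_distrib power_divide algebra_simps)
    finally show "Re (phase lam * T x) \<le> B x" .
  qed
  also have "(LINT x|lebesgue. B x) = 4 * L2_sqnorm w - L2_sqnorm w' / 2 + (1/4 + d\<^sup>2/2) * L2_sqnorm z"
    unfolding B_def L2_sqnorm_def using iB by simp
  finally show ?thesis by simp
qed

text \<open>
Test the equation with the conjugate of \<open>z\<close>. The integral of \<open>z'\<close> times this conjugate equals minus its own conjugate, so the
real part of the integrand may be dropped: this is the replacement by \<open>J\<close>. The rotation then turns \<open>J\<close> into plus or minus its imaginary part,
of modulus at most \<open>\<bar>z'\<bar> \<bar>z\<bar>\<close>, and the diffusion term \<open>- D \<bar>z'\<bar>\<^sup>2\<close> absorbs it completely. Splitting the coupling term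
with weights 1 and 1/2 makes the coefficient of \<open>\<bar>z\<bar>\<^sup>2\<close> equal to \<open>p - r\<close>, which is what the supremum \<open>M\<close> of the
theorem controls.
\<close>

lemma energy_estimate_z:
  assumes z: "H2 z z' z''" and w': "L2 w'" and "D > 0"
    and r: "r \<in> borel_measurable lebesgue" "\<And>x. \<bar>r x\<bar> \<le> C"
    and p: "p \<in> borel_measurable lebesgue" "\<And>x. 0 \<le> p x" "\<And>x. p x \<le> P"
    and m: "\<And>x. p x - r x \<le> m"
    and eq: "AE x in lebesgue. lam * z x + of_real (r x) * z x = z' x - of_real (p x) * w' x + of_real D * z'' x"
  shows "(Re lam + \<bar>Im lam\<bar>) * L2_sqnorm z \<le> (1 / (4 * D) + m) * L2_sqnorm z + P / 2 * L2_sqnorm w'"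
proof -
  have L: "L2 z" "L2 z'" "L2 z''" "weak_deriv z z'" "weak_deriv z' z''"
    using z by (auto simp: H2_def)
  define T0 where "T0 x = of_real (r x) * z x * cnj (z x) + of_real (p x) * w' x * cnj (z x)" for x
  define J where "J x = \<i> * of_real (Im (z' x * cnj (z x)))" for x
  define T where "T x = J x - T0 x - of_real D * (z' x * cnj (z' x))" for x
  have iT0: "integrable lebesgue T0"
    unfolding T0_def using L w' r p
    by (intro Bochner_Integration.integrable_add weighted_L2_mult_integrable) auto
  note i = iT0 L2_mult_cnj_integrable[OF L(2,1)] L2_mult_cnj_integrable[OF L(2,2)]
    L2_mult_cnj_integrable[OF L(3,1)] L2_mult_cnj_integrable[OF L(1,1)]
  have iJ: "integrable lebesgue J" unfolding J_def using i by (intro integrable_mult_right integrable_of_real integrable_Im)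
  have iT: "integrable lebesgue T" unfolding T_def using i iJ by simp
  have J: "(LINT x|lebesgue. z' x * cnj (z x)) = (LINT x|lebesgue. J x)"
  proof -
    have "(LINT x|lebesgue. z' x * cnj (z x)) = - (LINT x|lebesgue. cnj (z' x * cnj (z x)))"
      using H1_integration_by_parts[OF L(1,2,4) L(1,2,4)] by (simp add: mult.commute)
    also have "\<dots> = - cnj (LINT x|lebesgue. z' x * cnj (z x))"
      by (simp only: Bochner_Integration.integral_cnj)
    finally have "Re (LINT x|lebesgue. z' x * cnj (z x)) = 0" by (simp add: complex_eq_iff)
    then have "(LINT x|lebesgue. z' x * cnj (z x)) = \<i> * of_real (LINT x|lebesgue. Im (z' x * cnj (z x)))"
      using i by (simp add: complex_eq_iff del: times_complex.sel)
    then show ?thesis unfolding J_def by (simp del: times_complex.sel)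
  qed
  have "lam * of_real (L2_sqnorm z) = (LINT x|lebesgue. lam * (z x * cnj (z x)))"
    using i by (simp add: LINT_mult_cnj_self[OF L(1)])
  also have "\<dots> = (LINT x|lebesgue. z' x * cnj (z x) - T0 x + of_real D * (z'' x * cnj (z x)))"
  proof (rule integral_cong_AE)
    show "AE x in lebesgue. lam * (z x * cnj (z x)) = z' x * cnj (z x) - T0 x + of_real D * (z'' x * cnj (z x))"
      using eq
    proof eventually_elim
      case (elim x)
      from arg_cong[OF this, of "\<lambda>t. t * cnj (z x)"] show ?case
        by (simp add: T0_def algebra_simps)
    qed
  qed (use i in \<open>auto intro!: borel_measurable_integrable\<close>)
  also have "\<dots> = (LINT x|lebesgue. J x) - (LINT x|lebesgue. T0 x) + of_real D * (LINT x|lebesgue. z'' x * cnj (z x))"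
    unfolding J[symmetric] using i by simp
  also have "\<dots> = (LINT x|lebesgue. T x)"
    unfolding T_def using i iJ by (simp add: H1_integration_by_parts[OF L(2,3,5) L(1,2,4)])
  finally have eqT: "lam * of_real (L2_sqnorm z) = (LINT x|lebesgue. T x)" .
  define B where "B x = (1 / (4 * D) + m) * (norm (z x))\<^sup>2 + P / 2 * (norm (w' x))\<^sup>2" for x
  note iB = L2_norm_square[OF L(1)] L2_norm_square[OF w']
  have "(Re lam + \<bar>Im lam\<bar>) * L2_sqnorm z \<le> (LINT x|lebesgue. B x)"
  proof (rule phase_LINT_le[OF iT _ eqT])
    show "integrable lebesgue B" unfolding B_def using iB by simp
    fix x
    have zz: "y * cnj y = of_real ((norm y)\<^sup>2)" for y by (simp only: complex_norm_square)
    have expand: "Re (phase lam * T x) = Re (phase lam * J x) - r x * (norm (z x))\<^sup>2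
        - p x * Re (phase lam * (w' x * cnj (z x))) - D * (norm (z' x))\<^sup>2"
      unfolding T_def T0_def mult.assoc zz by (simp add: Re_phase algebra_simps)
    have transport: "Re (phase lam * J x) \<le> norm (z' x) * norm (z x)"
    proof -
      have "Re (phase lam * J x) \<le> \<bar>Im (z' x * cnj (z x))\<bar>"
        by (simp add: J_def phase_def del: times_complex.sel) (simp add: abs_if mult.commute)
      also have "\<dots> \<le> norm (z' x * cnj (z x))" by (rule abs_Im_le_cmod)
      finally show ?thesis by (simp add: norm_mult)
    qed
    have young: "norm (z' x) * norm (z x) \<le> D * (norm (z' x))\<^sup>2 + (norm (z x))\<^sup>2 / (4 * D)"
    proof -
      have "0 \<le> (2 * D * norm (z' x) - norm (z x))\<^sup>2 / (4 * D)" using \<open>D > 0\<close> by simp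
      also have "\<dots> = D * (norm (z' x))\<^sup>2 + (norm (z x))\<^sup>2 / (4 * D) - norm (z' x) * norm (z x)"
        using \<open>D > 0\<close> by (simp add: power2_diff power_mult_distrib field_simps power2_eq_square)
      finally show ?thesis by simp
    qed
    have coupling: "- (p x * Re (phase lam * (w' x * cnj (z x)))) \<le> p x * ((norm (z x))\<^sup>2 + (norm (w' x))\<^sup>2 / 2)"
    proof -
      have "- Re (phase lam * (w' x * cnj (z x))) = Re (phase lam * - (w' x * cnj (z x)))" by simp
      also have "\<dots> \<le> sqrt 2 * norm (- (w' x * cnj (z x)))" by (rule Re_phase_le)
      also have "\<dots> \<le> (norm (z x))\<^sup>2 + (norm (w' x))\<^sup>2 / 2"
        using sqrt2_mult_le(2)[of "norm (z x)" "norm (w' x)"] by (simp add: norm_mult mult.commute)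
      finally have "p x * - Re (phase lam * (w' x * cnj (z x))) \<le> p x * ((norm (z x))\<^sup>2 + (norm (w' x))\<^sup>2 / 2)"
        by (rule mult_left_mono) (rule p(2))
      then show ?thesis by (simp only: mult_minus_right)
    qed
    have "Re (phase lam * T x) \<le> (norm (z x))\<^sup>2 / (4 * D) - r x * (norm (z x))\<^sup>2
        + p x * ((norm (z x))\<^sup>2 + (norm (w' x))\<^sup>2 / 2)"
      using expand transport young coupling by linarith
    also have "\<dots> = (norm (z x))\<^sup>2 / (4 * D) + (p x - r x) * (norm (z x))\<^sup>2 + p x / 2 * (norm (w' x))\<^sup>2"
      by (simp add: algebra_simps)
    also have "\<dots> \<le> (norm (z x))\<^sup>2 / (4 * D) + m * (norm (z x))\<^sup>2 + P / 2 * (norm (w' x))\<^sup>2"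
      using m[of x] p(3)[of x] by (intro add_mono mult_right_mono) auto
    also have "\<dots> = B x" by (simp add: B_def algebra_simps)
    finally show "Re (phase lam * T x) \<le> B x" .
  qed
  also have "(LINT x|lebesgue. B x) = (1 / (4 * D) + m) * L2_sqnorm z + P / 2 * L2_sqnorm w'"
    unfolding B_def L2_sqnorm_def using iB by simp
  finally show ?thesis .
qed

lemma L2_sqnorm_eq_0:
  assumes "L2 f" "L2_sqnorm f = 0" shows "AE x in lebesgue. f x = 0"
  using assms integral_nonneg_eq_0_iff_AE[OF L2_norm_square[OF assms(1)]] by (simp add: L2_sqnorm_def)

lemma L2_sqnorm_nonneg: "0 \<le> L2_sqnorm f"
  by (simp add: L2_sqnorm_def)

section \<open>The bound on unstable eigenvalues\<close>

theorem proposition4: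
  fixes D k q u_plus u_minus u_ig E_A L M :: real
    and \<phi> uh zh :: "real \<Rightarrow> real" and lam :: complex
  assumes "D > 0" and "k > 0" and "E_A > 0"
    and "\<phi> = ignition u_ig E_A"
    and "strong_detonation_profile D k q u_plus u_minus u_ig \<phi> uh zh"
    and "L = (SUP x. deriv \<phi> (uh x) * zh x)"
    and "M = (SUP x. (1 + q) * deriv \<phi> (uh x) * zh x - \<phi> (uh x))"
    and "integrated_eigenvalue D k q \<phi> uh zh lam"
    and "Re lam \<ge> 0"
  shows "Re lam + \<bar>Im lam\<bar>
    \<le> max 4 (1 / (4 * D) + (1 / 4 + 1 / 2 * \<bar>D - 1\<bar>\<^sup>2) * k * L + k * M)"
proof -
  define p where "p x = deriv \<phi> (uh x) * zh x" for x
  define \<mu> where "\<mu> = Re lam + \<bar>Im lam\<bar>"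
  have \<phi>_smooth: "smooth \<phi>" and \<phi>: "\<And>v. 0 \<le> \<phi> v" "\<And>v. \<phi> v \<le> 1"
    and \<phi>': "\<And>v. 0 \<le> deriv \<phi> v" "\<And>v. deriv \<phi> v \<le> 2 / E_A"
    using assms(3,4) ignition_smooth ignition_bounds deriv_ignition_bounds by auto
  have sm: "smooth uh" "smooth zh" and zh: "\<And>x. 0 \<le> zh x" "\<And>x. zh x \<le> 1"
    and up: "0 \<le> u_plus" "u_plus < 1" and q: "0 < q" "q < (1 - u_plus)\<^sup>2 / 2"
    using assms(5) by (auto simp: strong_detonation_profile_def)
  have "(1 - u_plus)\<^sup>2 \<le> 1" using up by (simp add: power_le_one)
  with q have q_half: "q \<le> 1 / 2" by simp
  have range: "0 \<le> uh x" "uh x \<le> 2" for x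
    using profile_range[OF assms(1,2) \<phi>(1) assms(5), of x] up by auto
  have p: "0 \<le> p x" "p x \<le> 2 / E_A" for x
    using \<phi>'[of "uh x"] zh[of x] mult_mono[of "deriv \<phi> (uh x)" "2 / E_A" "zh x" 1] assms(3)
    by (auto simp: p_def)
  have p_L: "p x \<le> L" for x
    unfolding assms(6) using p(2) by (fold p_def) (auto intro!: cSUP_upper bdd_aboveI[of _ "2 / E_A"])
  have p_M: "(1 + q) * p x - \<phi> (uh x) \<le> M" for x
  proof -
    have "(1 + q) * p y - \<phi> (uh y) \<le> (1 + q) * (2 / E_A)" for y
      using mult_left_mono[OF p(2)[of y], of "1 + q"] \<phi>(1)[of "uh y"] q(1) by simp
    then have "bdd_above (range (\<lambda>y. (1 + q) * p y - \<phi> (uh y)))"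
      by (intro bdd_aboveI[of _ "(1 + q) * (2 / E_A)"]) auto
    then show ?thesis
      unfolding assms(7) mult.assoc p_def[symmetric] by (intro cSUP_upper) auto
  qed
  have L0: "0 \<le> L" using p(1) p_L order.trans by blast
  have cont_comp: "continuous_on UNIV (\<lambda>x. f (uh x))" if "smooth f" for f
    by (rule continuous_on_compose2[OF smooth_continuous_on[OF that, of UNIV] smooth_continuous_on[OF sm(1)]]) simp
  have cont: "continuous_on UNIV uh" "continuous_on UNIV (\<lambda>x. \<phi> (uh x))" "continuous_on UNIV p"
    unfolding p_def
    by (intro continuous_on_mult cont_comp smooth_deriv \<phi>_smooth smooth_continuous_on sm)+
  from assms(8) obtain w w' w'' z z' z'' where H: "H2 w w' w''" "H2 z z' z''"
    and nonzero: "\<not> (AE x in lebesgue. w x = 0 \<and> z x = 0)"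
    and eqw: "AE x in lebesgue. lam * w x = of_real (1 - uh x) * w' x + of_real (q * uh x) * z x
             + of_real (q * (D - 1)) * z' x + w'' x"
    and eqz: "AE x in lebesgue.
           lam * z x + of_real (k * (\<phi> (uh x) - q * deriv \<phi> (uh x) * zh x)) * z x
             = z' x - of_real (k * deriv \<phi> (uh x) * zh x) * w' x + of_real D * z'' x"
    unfolding integrated_eigenvalue_def by blast
  have L2s: "L2 w" "L2 w'" "L2 z" using H by (auto simp: H2_def)
  have "\<mu> * L2_sqnorm w + L2_sqnorm w' / 2 \<le> 4 * L2_sqnorm w + (1/4 + \<bar>D - 1\<bar>\<^sup>2 / 2) * L2_sqnorm z"
    unfolding \<mu>_def
  proof (rule energy_estimate_w[OF H _ _ _ _ _ eqw])
    show "\<bar>1 - uh x\<bar> \<le> 1" for x using range[of x] by auto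
    show "\<bar>q * uh x\<bar> \<le> 1" for x
      using range[of x] q mult_mono[of q "1/2" "uh x" 2] q_half by simp
    show "\<bar>q * (D - 1)\<bar> \<le> \<bar>D - 1\<bar> / 2"
      using q q_half mult_right_mono[of q "1/2" "\<bar>D - 1\<bar>"] by (simp add: abs_mult)
  qed (auto intro!: continuous_lebesgue_measurable continuous_intros cont)
  then have estimate_w: "L2_sqnorm w' / 2 \<le> (4 - \<mu>) * L2_sqnorm w + (1/4 + 1/2 * \<bar>D - 1\<bar>\<^sup>2) * L2_sqnorm z"
    by (simp add: algebra_simps)
  have estimate_z: "\<mu> * L2_sqnorm z \<le> (1 / (4 * D) + k * M) * L2_sqnorm z + k * L / 2 * L2_sqnorm w'"
    unfolding \<mu>_def
  proof (rule energy_estimate_z[where r = "\<lambda>x. k * (\<phi> (uh x) - q * p x)" and p = "\<lambda>x. k * p x"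
        and C = "k * (1 + q * (2 / E_A))"])
    show "\<bar>k * (\<phi> (uh x) - q * p x)\<bar> \<le> k * (1 + q * (2 / E_A))" for x
    proof -
      have "0 \<le> q * p x" "q * p x \<le> q * (2 / E_A)" using p[of x] q(1) by (simp_all only: mult_left_mono mult_nonneg_nonneg less_imp_le)
      then have "\<bar>\<phi> (uh x) - q * p x\<bar> \<le> 1 + q * (2 / E_A)" using \<phi>[of "uh x"] by linarith
      then show ?thesis using assms(2) by (simp add: abs_mult)
    qed
    show "k * p x - k * (\<phi> (uh x) - q * p x) \<le> k * M" for x
      using mult_left_mono[OF p_M[of x], of k] assms(2) by (simp add: algebra_simps)
    show "AE x in lebesgue. lam * z x + of_real (k * (\<phi> (uh x) - q * p x)) * z x
        = z' x - of_real (k * p x) * w' x + of_real D * z'' x"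
      using eqz by (simp only: p_def mult.assoc)
  qed (use H L2s assms(1,2) p p_L in \<open>auto intro!: continuous_lebesgue_measurable continuous_intros cont mult_left_mono\<close>)
  show ?thesis
  proof (rule ccontr)
    \<comment> \<open>both entries of the maximum are exceeded: \<open>\<mu> > 4\<close> removes \<open>w\<close> from the first estimate, the other inequality forces \<open>z = 0\<close>\<close>
    assume "\<not> ?thesis"
    then have \<mu>4: "4 < \<mu>" and \<mu>: "1 / (4 * D) + (1 / 4 + 1 / 2 * \<bar>D - 1\<bar>\<^sup>2) * k * L + k * M < \<mu>"
      by (auto simp: \<mu>_def)
    have "(4 - \<mu>) * L2_sqnorm w \<le> 0" using \<mu>4 L2_sqnorm_nonneg by (simp add: mult_nonpos_nonneg)
    then have "L2_sqnorm w' / 2 \<le> (1/4 + 1/2 * \<bar>D - 1\<bar>\<^sup>2) * L2_sqnorm z" using estimate_w by linarith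
    from mult_left_mono[OF this, of "k * L"] assms(2) L0
    have "k * L / 2 * L2_sqnorm w' \<le> (1/4 + 1/2 * \<bar>D - 1\<bar>\<^sup>2) * k * L * L2_sqnorm z" by (simp add: mult_ac)
    with estimate_z
    have "(\<mu> - (1 / (4 * D) + (1 / 4 + 1 / 2 * \<bar>D - 1\<bar>\<^sup>2) * k * L + k * M)) * L2_sqnorm z \<le> 0"
      by (simp add: algebra_simps)
    then have z0: "L2_sqnorm z = 0"
      using \<mu> L2_sqnorm_nonneg[of z] by (simp add: mult_le_0_iff)
    then have "(\<mu> - 4) * L2_sqnorm w \<le> 0" using estimate_w L2_sqnorm_nonneg[of w'] by (simp add: algebra_simps)
    then have "L2_sqnorm w = 0" using \<mu>4 L2_sqnorm_nonneg[of w] by (simp add: mult_le_0_iff)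
    with z0 L2s have "AE x in lebesgue. w x = 0 \<and> z x = 0" by (simp add: L2_sqnorm_eq_0)
    with nonzero show False by simp
  qed
qed

end
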